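(* Let $n$ be a positive integer. Let $\sim$ be the equivalence relation on the set of nonnegative integer sequences $(c_1,\dots,c_n)$ with $c_1+\cdots+c_n=n$ given by $(c_1,\dots,c_n)\sim(c_1',\dots,c_n')$ whenever $(c_1,\dots,c_n,0)$ is a cyclic shift of $(c_1',\dots,c_n',0)$. For a fixed $(c_1,\dots,c_n)$, we have $$\sum_{(c_1',\dots,c_n')\sim(c_1,\dots,c_n)}A_{c_1',\dots,c_n'}=n!,$$ i.e. the sum of the mixed Eulerian numbers in each equivalence class is $n!$. There are exactly $C_n=\frac{1}{n+1}\binom{2n}{n}$ equivalence classes.
   Context: For $1\le k\le n$, the hypersimplex $\Delta_{k,n+1}\subset\mathbb{R}^{n+1}$ is the convex hull of all $0/1$-vectors with exactly $k$ ones. For a polytope $P$ in a hyperplane $t_1+\cdots+t_{n+1}=c$ of $\mathbb{R}^{n+1}$, $\mathrm{Vol}\,P$ is the usual $n$-dimensional volume of the image of $P$ under the projection $(t_1,\dots,t_{n+1})\mapsto(t_1,\dots,t_n)$. For $u_1,\dots,u_n\ge0$ the volume of the Minkowski sum $u_1\Delta_{1,n+1}+\cdots+u_n\Delta_{n,n+1}$ is a homogeneous polynomial of degree $n$ in $u_1,\dots,u_n$, and the mixed Eulerian numbers $A_{c_1,\dots,c_n}$ (for integers $c_1,\dots,c_n\ge0$ with $c_1+\cdots+c_n=n$) are defined by $$\mathrm{Vol}(u_1\Delta_{1,n+1}+\cdots+u_n\Delta_{n,n+1})=\sum_{c_1,\dots,c_n}A_{c_1,\dots,c_n}\frac{u_1^{c_1}}{c_1!}\cdots\frac{u_n^{c_n}}{c_n!}.$$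 Equivalently, $A_{c_1,\dots,c_n}$ is $n!$ times the mixed volume of the hypersimplices in which $\Delta_{k,n+1}$ is repeated $c_k$ times. *)

theory Defs
  imports "HOL-Analysis.Analysis" "HOL-Library.Function_Algebras" "HOL-Library.Set_Algebras"
begin

text \<open>
  To keep the dimension a term of type \<^typ>\<open>nat\<close>, the space $\mathbb{R}^m$ is
  represented by the functions \<^typ>\<open>nat \<Rightarrow> real\<close> that vanish outside \<open>{1..m}\<close>. The pointwise
  vector space structure makes the library's convex hull available on it.
\<close>

instantiation "fun" :: (type, real_vector) real_vector
begin

definition scaleR_fun :: "real \<Rightarrow> ('a \<Rightarrow> 'b) \<Rightarrow> 'a \<Rightarrow> 'b" where
  "scaleR_fun r f = (\<lambda>x. r *\<^sub>R f x)"

instance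
  by standard (simp_all add: scaleR_fun_def fun_eq_iff scaleR_add_right scaleR_add_left)

end

text \<open>The hypersimplex $\Delta_{k,m} \subset \mathbb{R}^m$.\<close>

definition hypersimplex :: "nat \<Rightarrow> nat \<Rightarrow> (nat \<Rightarrow> real) set" where
  "hypersimplex k m =
     convex hull {t. (\<forall>i\<in>{1..m}. t i \<in> {0, 1}) \<and> (\<forall>i. i \<notin> {1..m} \<longrightarrow> t i = 0) \<and>
                     card {i\<in>{1..m}. t i = 1} = k}"

text \<open>
  For a polytope $P$ in a hyperplane $t_1 + \dots + t_{n+1} = c$: the $n$-dimensional Lebesgue
  measure of its projection along the last coordinate. The projection of a polytope is compact,
  so the uncompleted product measure suffices.
\<close>

definition proj_vol :: "nat \<Rightarrow> (nat \<Rightarrow> real) set \<Rightarrow> real" where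
  "proj_vol n P = measure (\<Pi>\<^sub>M i\<in>{1..n}. lborel) ((\<lambda>t. restrict t {1..n}) ` P)"

text \<open>
  A sequence $(c_1, \dots, c_n)$ is a list, so $c_k$ is \<open>c ! (k - 1)\<close>.
\<close>

definition weak_comps :: "nat \<Rightarrow> nat list set" where
  "weak_comps n = {c. length c = n \<and> sum_list c = n}"

lemma finite_weak_comps: "finite (weak_comps n)"
proof (rule finite_subset)
  show "weak_comps n \<subseteq> {c. set c \<subseteq> {..n} \<and> length c = n}"
    using member_le_sum_list by (fastforce simp: weak_comps_def)
  show "finite {c. set c \<subseteq> {..n} \<and> length c = n}"
    by (rule finite_lists_length_eq) simp
qed

text \<open>
  The numbers $A_{c_1, \dots, c_n}$, for $c_1 + \dots + c_n = n$, as the coefficients of the volume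
  polynomial. The value 0 elsewhere only serves to make the family unique as a function on lists.
  The sums and images of sets below are Minkowski sums and dilations.
\<close>

definition mixed_eulerian :: "nat \<Rightarrow> nat list \<Rightarrow> real" where
  "mixed_eulerian n = (THE A.
     (\<forall>c. c \<notin> weak_comps n \<longrightarrow> A c = 0) \<and>
     (\<forall>u. (\<forall>k\<in>{1..n}. 0 \<le> u k) \<longrightarrow>
        proj_vol n (\<Sum>k=1..n. (\<lambda>t. u k *\<^sub>R t) ` hypersimplex k (n + 1)) =
        (\<Sum>c\<in>weak_comps n. A c * (\<Prod>k=1..n. u k ^ (c ! (k - 1)) / fact (c ! (k - 1))))))"

definition cyclic_equiv :: "nat \<Rightarrow> (nat list \<times> nat list) set" where
  "cyclic_equiv n = {(c, c'). c \<in> weak_comps n \<and> c' \<in> weak_comps n \<and>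
                              (\<exists>m. c @ [0] = rotate m (c' @ [0]))}"

lemma equiv_cyclic_equiv: "equiv (weak_comps n) (cyclic_equiv n)"
proof (rule equivI)
  show "cyclic_equiv n \<subseteq> weak_comps n \<times> weak_comps n"
    by (auto simp: cyclic_equiv_def)
  show "refl_on (weak_comps n) (cyclic_equiv n)"
    by (auto simp: refl_on_def cyclic_equiv_def intro: exI[of _ 0])
  show "sym (cyclic_equiv n)"
  proof (rule symI)
    fix c c' assume cc': "(c, c') \<in> cyclic_equiv n"
    then obtain m where m: "c @ [0] = rotate m (c' @ [0])"
      by (auto simp: cyclic_equiv_def)
    define N where "N = length (c' @ [0])"
    have "m mod N \<le> N"
      by (simp add: N_def less_imp_le)
    moreover have "c @ [0] = rotate (m mod N) (c' @ [0])"
      using m unfolding N_def by (metis rotate_conv_mod)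
    ultimately have "rotate (N - m mod N) (c @ [0]) = rotate N (c' @ [0])"
      by (simp add: rotate_rotate)
    then have "c' @ [0] = rotate (N - m mod N) (c @ [0])"
      by (simp add: N_def del: length_append)
    then show "(c', c) \<in> cyclic_equiv n"
      using cc' by (auto simp: cyclic_equiv_def)
  qed
  show "trans (cyclic_equiv n)"
  proof (rule transI)
    fix a b c assume "(a, b) \<in> cyclic_equiv n" "(b, c) \<in> cyclic_equiv n"
    then show "(a, c) \<in> cyclic_equiv n"
      unfolding cyclic_equiv_def by (auto simp: rotate_rotate)
  qed
qed

end

theory Submission
  imports Defs "HOL-Computational_Algebra.Polynomial"
begin

text \<open>
  Slice the Minkowski sum by fixing one coordinate to be \<open>s\<close>. The slice is again a Minkowski sum of
  hypersimplices, of one dimension less: for \<open>s\<close> in the \<open>k\<close>-th of \<open>n\<close> consecutive intervals, which has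
  length $u_k$, its parameters arise from $(u_1, \dots, u_n)$ by deleting $u_k$ and distributing it,
  as $r$ and $u_k - r$, over its two neighbours. In terms of divided powers this gives the recursion
  $$A_c = \sum_k \sum_{i + j = c_k - 1} A_{(\dots, c_{k-1} + i, c_{k+1} + j, \dots)}$$
  because $\int_0^u \frac{r^i}{i!} \frac{(u - r)^j}{j!} dr = \frac{u^{i+j+1}}{(i+j+1)!}$. On the cyclic
  sequence $(c_1, \dots, c_n, 0)$ the operation commutes with rotation, so the sum $B(c)$ of
  the coefficients over all rotations satisfies $B(c) = \sum_l c_l \cdot (n-1)! = n!$ by induction. All
  $n + 1$ rotations are distinct, as $n$ and $n + 1$ are coprime, so this sum runs over the class once, and
  the classes correspond to the $\frac{1}{n+1} \binom{2n}{n}$ orbits of sequences of length $n + 1$ and sum \<open>n\<close>.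
\<close>

section \<open>The recursion on cyclic sequences\<close>

lemma sum_list_rotate:
  fixes xs :: "'a::comm_monoid_add list"
  shows "sum_list (rotate k xs) = sum_list xs"
proof (induction k)
  case (Suc k)
  have "sum_list (rotate1 ys) = sum_list ys" for ys :: "'a list"
    by (cases ys) (simp_all add: add.commute)
  then show ?case
    using Suc by simp
qed simp

text \<open>Shifting the index modulo \<open>N\<close> rotates the list of values.\<close>

lemma sum_shift_mod:
  fixes F :: "nat \<Rightarrow> 'a::comm_monoid_add"
  shows "(\<Sum>j<N. F ((j + k) mod N)) = (\<Sum>j<N. F j)"
proof -
  have "rotate k (map F [0..<N]) = map (\<lambda>j. F ((j + k) mod N)) [0..<N]"
    by (rule nth_equalityI) (auto simp: nth_rotate add.commute)
  then have "sum_list (map (\<lambda>j. F ((j + k) mod N)) [0..<N]) = sum_list (map F [0..<N])"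
    by (metis sum_list_rotate)
  then show ?thesis
    by (simp add: interv_sum_list_conv_sum_set_nat atLeast0LessThan)
qed

text \<open>
  Read cyclically, the head of the list is removed, with \<open>a\<close> added to its successor and \<open>b\<close> to its
  predecessor; on a two-element list these coincide.
\<close>

definition cmerge :: "'a::comm_monoid_add \<Rightarrow> 'a \<Rightarrow> 'a list \<Rightarrow> 'a list" where
  "cmerge a b xs = map (\<lambda>q. xs ! Suc q + (if q = 0 then a else 0) +
     (if Suc (Suc q) = length xs then b else 0)) [0..<length xs - 1]"

lemma length_cmerge [simp]: "length (cmerge a b xs) = length xs - 1"
  by (simp add: cmerge_def)

text \<open>With \<open>a + b = xs ! 0 - 1\<close> both the length and the total drop by one, so
  merging stays among the sequences whose sum is one less than their length.\<close>

lemma sum_list_cmerge: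
  assumes "length xs = Suc (Suc n)"
  shows "xs ! 0 + sum_list (cmerge a b xs) = sum_list xs + a + b"
proof -
  have "sum_list (cmerge a b xs) = (\<Sum>q<Suc n. xs ! Suc q) + a + b"
    using assms
    by (simp add: cmerge_def interv_sum_list_conv_sum_set_nat atLeast0LessThan sum.distrib
        sum.delta algebra_simps del: upt_Suc sum.lessThan_Suc)
  moreover have "sum_list xs = xs ! 0 + (\<Sum>q<Suc n. xs ! Suc q)"
    using assms by (simp add: sum_list_sum_nth atLeast0LessThan sum.lessThan_Suc_shift del: sum.lessThan_Suc)
  ultimately show ?thesis
    by (simp add: algebra_simps)
qed

text \<open>
  Coefficients of the volume polynomial, as a function of the cyclic sequence $(c_1, \dots, c_n, 0)$.
  The final rotation brings the distinguished last entry back to the end, so it is never one of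
  the removed entries \<open>c ! k\<close>.
\<close>

primrec cyc_eulerian :: "nat \<Rightarrow> nat list \<Rightarrow> nat" where
  "cyc_eulerian 0 c = 1"
| "cyc_eulerian (Suc n) c = (\<Sum>k<Suc n. \<Sum>i<c ! k.
     cyc_eulerian n (rotate (Suc n - k) (cmerge (c ! k - Suc i) i (rotate k c))))"

text \<open>Over all rotations, each entry of \<open>c\<close> stands once at each removable
  position \<open>k\<close>. For a fixed removed entry and split, varying \<open>k\<close> yields
  all rotations of the merged sequence, so the induction hypothesis contributes
  \<open>fact n\<close> for each unit of \<open>sum_list c\<close>.\<close>

lemma sum_cyc_eulerian_rotate:
  assumes "length c = Suc n" "sum_list c = n"
  shows "(\<Sum>j<Suc n. cyc_eulerian n (rotate j c)) = fact n"
  using assms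
proof (induction n arbitrary: c)
  case (Suc n)
  \<comment> \<open>\<open>G k l\<close> is the contribution of removing entry \<open>l\<close> of
    \<open>c\<close> when it stands at position \<open>k\<close> of the rotated sequence; only the
    final rotation depends on \<open>k\<close>.\<close>
  define G where "G k l = (\<Sum>i<c ! l. cyc_eulerian n (rotate (Suc n - k)
      (cmerge (c ! l - Suc i) i (rotate l c))))" for k l
  have step: "cyc_eulerian (Suc n) (rotate j c) = (\<Sum>k<Suc n. G k ((j + k) mod Suc (Suc n)))"
    if "j < Suc (Suc n)" for j
  proof -
    have "rotate k (rotate j c) = rotate ((j + k) mod Suc (Suc n)) c" for k
      using Suc.prems by (metis add.commute rotate_rotate rotate_conv_mod)
    then show ?thesis
      using Suc.prems by (simp add: G_def nth_rotate del: sum.lessThan_Suc)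
  qed
  have "(\<Sum>j<Suc (Suc n). cyc_eulerian (Suc n) (rotate j c)) =
      (\<Sum>j<Suc (Suc n). \<Sum>k<Suc n. G k ((j + k) mod Suc (Suc n)))"
    using step by (intro sum.cong) auto
  also have "\<dots> = (\<Sum>k<Suc n. \<Sum>j<Suc (Suc n). G k ((j + k) mod Suc (Suc n)))"
    by (rule sum.swap)
  also have "\<dots> = (\<Sum>k<Suc n. \<Sum>l<Suc (Suc n). G k l)"
    by (intro sum.cong refl sum_shift_mod)
  also have "\<dots> = (\<Sum>l<Suc (Suc n). \<Sum>k<Suc n. G k l)"
    by (rule sum.swap)
  also have "\<dots> = (\<Sum>l<Suc (Suc n). \<Sum>i<c ! l. \<Sum>k<Suc n. cyc_eulerian n (rotate (Suc n - k)
      (cmerge (c ! l - Suc i) i (rotate l c))))"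
    unfolding G_def by (intro sum.cong refl sum.swap)
  also have "\<dots> = (\<Sum>l<Suc (Suc n). \<Sum>i<c ! l. fact n)"
  proof (intro sum.cong refl)
    fix l i assume l: "l \<in> {..<Suc (Suc n)}" and i: "i \<in> {..<c ! l}"
    define d where "d = cmerge (c ! l - Suc i) i (rotate l c)"
    have len: "length d = Suc n"
      using Suc.prems by (simp add: d_def)
    have "rotate l c ! 0 = c ! l"
      using Suc.prems l by (simp add: nth_rotate)
    then have "sum_list d = n"
      using sum_list_cmerge[of "rotate l c" n "c ! l - Suc i" i] Suc.prems l i
      by (simp add: d_def sum_list_rotate)
    \<comment> \<open>The exponents \<open>Suc n - k\<close> run from 1 to \<open>Suc n\<close>;
      modulo the length \<open>Suc n\<close> these are all rotations once.\<close>
    have "(\<Sum>k<Suc n. cyc_eulerian n (rotate (Suc n - k) d)) =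
        (\<Sum>k<Suc n. cyc_eulerian n (rotate (Suc k) d))"
      by (rule sum.reindex_bij_witness[of _ "\<lambda>k. n - k" "\<lambda>k. n - k"]) (auto simp: Suc_diff_le)
    also have "\<dots> = (\<Sum>k<Suc n. cyc_eulerian n (rotate ((k + 1) mod Suc n) d))"
      using len by (metis (no_types, lifting) Suc_eq_plus1 rotate_conv_mod)
    also have "\<dots> = (\<Sum>k<Suc n. cyc_eulerian n (rotate k d))"
      by (rule sum_shift_mod)
    also have "\<dots> = fact n"
      using len \<open>sum_list d = n\<close> by (rule Suc.IH)
    finally show "(\<Sum>k<Suc n. cyc_eulerian n (rotate (Suc n - k)
        (cmerge (c ! l - Suc i) i (rotate l c)))) = fact n"
      unfolding d_def .
  qed
  also have "\<dots> = sum_list c * fact n"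
    using Suc.prems
    by (simp add: sum_list_sum_nth atLeast0LessThan flip: sum_distrib_right del: sum.lessThan_Suc)
  also have "\<dots> = fact (Suc n)"
    using Suc.prems by simp
  finally show ?case .
qed simp

text \<open>In original positions, deleting entry \<open>k\<close> sends \<open>a\<close> to its
  successor, now at position \<open>k\<close>, and \<open>b\<close> to its predecessor, which for
  \<open>k = 0\<close> is the last entry. The two cases differ in which of the nested index
  reductions wraps around.\<close>

lemma nth_rotate_cmerge:
  assumes "length xs = Suc (Suc n)" "k \<le> n" "p \<le> n"
  shows "rotate (Suc n - k) (cmerge a b (rotate k xs)) ! p =
    (if p < k then xs ! p else xs ! Suc p) + (if p = k then a else 0) +
    (if Suc p = k \<or> (k = 0 \<and> p = n) then b else 0)"
proof -
  have q: "rotate (Suc n - k) (cmerge a b (rotate k xs)) ! p =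
      cmerge a b (rotate k xs) ! ((Suc n - k + p) mod Suc n)"
    using assms by (subst nth_rotate) auto
  show ?thesis
  proof (cases "p < k")
    case True
    then have "(Suc n - k + p) mod Suc n = Suc n - k + p"
      using assms by simp
    moreover have "k + Suc (Suc n - k + p) = p + Suc (Suc n)"
      using assms by simp
    then have "(k + Suc (Suc n - k + p)) mod Suc (Suc n) = p"
      using assms by (simp only: mod_add_self2) simp
    ultimately show ?thesis
      using True assms unfolding q by (auto simp: cmerge_def nth_rotate simp del: upt_Suc)
  next
    case False
    have "Suc n - k + p = p - k + Suc n"
      using False assms by simp
    then have "(Suc n - k + p) mod Suc n = p - k"
      using assms by (simp only: mod_add_self2) simp
    then show ?thesis
      using False assms unfolding q by (auto simp: cmerge_def nth_rotate simp del: upt_Suc)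
  qed
qed

text \<open>The last entry is never removed and merging cannot decrease it, so it stays positive
  down to \<open>n = 0\<close>, where it contradicts the sum being 0. Hence only rotations ending in
  0 contribute to class sums.\<close>

lemma cyc_eulerian_eq_0:
  assumes "length c = Suc n" "c ! n > 0" "sum_list c = n"
  shows "cyc_eulerian n c = 0"
  using assms
proof (induction n arbitrary: c)
  case 0
  then show ?case
    by (cases c) auto
next
  case (Suc n)
  have "cyc_eulerian n (rotate (Suc n - k) (cmerge (c ! k - Suc i) i (rotate k c))) = 0"
    if "k < Suc n" "i < c ! k" for k i
  proof (rule Suc.IH)
    show "length (rotate (Suc n - k) (cmerge (c ! k - Suc i) i (rotate k c))) = Suc n"
      using Suc.prems by simp
    show "rotate (Suc n - k) (cmerge (c ! k - Suc i) i (rotate k c)) ! n > 0"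
      using Suc.prems that by (subst nth_rotate_cmerge) auto
    have "rotate k c ! 0 = c ! k"
      using Suc.prems that by (simp add: nth_rotate)
    then show "sum_list (rotate (Suc n - k) (cmerge (c ! k - Suc i) i (rotate k c))) = n"
      using sum_list_cmerge[of "rotate k c" n "c ! k - Suc i" i] Suc.prems that
      by (simp add: sum_list_rotate)
  qed
  then show ?case
    by (simp del: sum.lessThan_Suc)
qed

section \<open>Integrals of divided powers\<close>

definition comps :: "nat \<Rightarrow> nat \<Rightarrow> nat list set" where
  "comps m d = {c. length c = m \<and> sum_list c = d}"

lemma finite_comps: "finite (comps m d)"
proof (rule finite_subset)
  show "comps m d \<subseteq> {c. set c \<subseteq> {..d} \<and> length c = m}"
    using member_le_sum_list by (fastforce simp: comps_def)
  show "finite {c. set c \<subseteq> {..d} \<and> length c = m}"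
    by (rule finite_lists_length_eq) simp
qed

definition dpow :: "real \<Rightarrow> nat \<Rightarrow> real" where
  "dpow x c = x ^ c / fact c"

lemma dpow_0 [simp]: "dpow x 0 = 1"
  by (simp add: dpow_def)

lemma dpow_zero: "dpow 0 c = (if c = 0 then 1 else 0)"
  by (simp add: dpow_def)

lemma dpow_add: "dpow (x + y) n = (\<Sum>i\<le>n. dpow x i * dpow y (n - i))"
proof -
  have "(x + y) ^ n / fact n = (\<Sum>i\<le>n. real (n choose i) * x ^ i * y ^ (n - i) / fact n)"
    by (simp add: binomial_ring sum_divide_distrib)
  also have "\<dots> = (\<Sum>i\<le>n. dpow x i * dpow y (n - i))"
    by (intro sum.cong) (auto simp: dpow_def binomial_fact field_simps)
  finally show ?thesis
    by (simp add: dpow_def)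
qed

lemma has_derivative_dpow_Suc:
  "((\<lambda>r. dpow r (Suc i)) has_field_derivative dpow r i) (at r within S)"
  using DERIV_cdivide[OF DERIV_pow[of "Suc i" r S], of "fact (Suc i)"]
  by (simp add: dpow_def divide_simps)

text \<open>The beta integral in divided powers. Integration by parts lowers \<open>j\<close> and
  raises \<open>i\<close>, which is why the induction keeps \<open>i\<close> arbitrary.\<close>

lemma has_integral_dpow_beta:
  assumes "0 \<le> v"
  shows "((\<lambda>r. dpow r i * dpow (v - r) j) has_integral dpow v (Suc (i + j))) {0..v}"
proof (induction j arbitrary: i)
  case 0
  have "((\<lambda>r. dpow r i) has_integral dpow v (Suc i) - dpow 0 (Suc i)) {0..v}"
    using assms
    by (intro fundamental_theorem_of_calculus)
      (auto simp flip: has_real_derivative_iff_has_vector_derivative intro: has_derivative_dpow_Suc)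
  then show ?case
    by (simp add: dpow_zero)
next
  case (Suc j)
  \<comment> \<open>An antiderivative of the difference of the integrands for
    \<open>(i, Suc j)\<close> and \<open>(Suc i, j)\<close>; it vanishes at both ends of the
    interval.\<close>
  define F where "F r = dpow r (Suc i) * dpow (v - r) (Suc j)" for r
  have "(F has_field_derivative
      dpow r i * dpow (v - r) (Suc j) - dpow r (Suc i) * dpow (v - r) j) (at r within S)" for r S
  proof -
    have "((\<lambda>r. dpow (v - r) (Suc j)) has_field_derivative (dpow (v - r) j * - 1)) (at r within S)"
      by (rule DERIV_chain2[OF has_derivative_dpow_Suc]) (auto intro!: derivative_eq_intros)
    from DERIV_mult[OF has_derivative_dpow_Suc this] show ?thesis
      unfolding F_def by (simp add: algebra_simps)
  qed
  then have "((\<lambda>r. dpow r i * dpow (v - r) (Suc j) - dpow r (Suc i) * dpow (v - r) j)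
      has_integral F v - F 0) {0..v}"
    using assms
    by (intro fundamental_theorem_of_calculus)
      (auto simp flip: has_real_derivative_iff_has_vector_derivative)
  then have "((\<lambda>r. dpow r i * dpow (v - r) (Suc j) - dpow r (Suc i) * dpow (v - r) j)
      has_integral 0) {0..v}"
    by (simp add: F_def dpow_zero)
  from has_integral_add[OF this Suc[of "Suc i"]] show ?case
    by simp
qed

definition dmonom :: "real list \<Rightarrow> nat list \<Rightarrow> real" where
  "dmonom xs c = prod_list (map2 dpow xs c)"

lemma dmonom_Nil [simp]: "dmonom [] [] = 1"
  by (simp add: dmonom_def)

lemma dmonom_Cons [simp]: "dmonom (x # xs) (a # c) = dpow x a * dmonom xs c"
  by (simp add: dmonom_def)

lemma dmonom_append [simp]:
  "length xs = length c \<Longrightarrow> dmonom (xs @ ys) (c @ d) = dmonom xs c * dmonom ys d"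
  by (simp add: dmonom_def)

lemma dmonom_rotate:
  assumes "length xs = length c"
  shows "dmonom (rotate k xs) (rotate k c) = dmonom xs c"
proof -
  have "map2 dpow (rotate k xs) (rotate k c) = rotate k (map2 dpow xs c)"
  proof (rule nth_equalityI)
    fix i assume "i < length (map2 dpow (rotate k xs) (rotate k c))"
    then have "i < length c" "(k + i) mod length c < length c"
      using assms by (auto intro!: mod_less_divisor)
    then show "map2 dpow (rotate k xs) (rotate k c) ! i = rotate k (map2 dpow xs c) ! i"
      using assms by (simp add: nth_rotate)
  qed (use assms in simp)
  moreover have "prod_list (rotate1 ys) = prod_list ys" for ys :: "real list"
    by (cases ys) simp_all
  then have "prod_list (rotate k ys) = prod_list ys" for ys :: "real list"
    by (induction k) simp_all
  ultimately show ?thesis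
    by (simp add: dmonom_def)
qed

lemma length_Suc_Suc_snocE:
  assumes "length xs = Suc (Suc m)"
  obtains x ys z where "xs = x # ys @ [z]" "length ys = m"
proof -
  obtain x xs' where "xs = x # xs'" "length xs' = Suc m"
    using assms by (auto simp: length_Suc_conv)
  moreover from this obtain ys z where "xs' = ys @ [z]"
    by (metis length_0_conv nat.distinct(1) rev_exhaust)
  ultimately show ?thesis
    using that by auto
qed

lemma length_Suc_Suc_Suc_snocE:
  assumes "length xs = Suc (Suc (Suc m))"
  obtains x y ys z where "xs = x # y # ys @ [z]" "length ys = m"
proof -
  obtain x xs' where "xs = x # xs'" "length xs' = Suc (Suc m)"
    using assms by (auto simp: length_Suc_conv)
  then show ?thesis
    using that by (auto elim: length_Suc_Suc_snocE)
qed

text \<open>From length three on the two neighbours of the head are different entries.\<close>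

lemma cmerge_snoc: "cmerge a b (x # y # ys @ [z]) = (y + a) # ys @ [z + b]"
  by (rule nth_equalityI)
    (auto simp: cmerge_def nth_append nth_Cons' less_Suc_eq simp del: upt_Suc)

text \<open>Binomial expansion of the two altered entries leaves beta integrals; collecting
  monomials moves the merging from the parameters to the exponents. The arbitrary \<open>G\<close>
  leaves room for rotated coefficients.\<close>

lemma has_integral_dmonom_cmerge:
  fixes G :: "nat list \<Rightarrow> real"
  assumes "length vs = Suc (Suc n)" "0 \<le> vs ! 0"
  shows "((\<lambda>r. \<Sum>c\<in>comps (Suc n) n. G c * dmonom (cmerge (vs ! 0 - r) r vs) c) has_integral
    (\<Sum>c\<in>comps (Suc (Suc n)) (Suc n). (\<Sum>i<c ! 0. G (cmerge (c ! 0 - Suc i) i c)) * dmonom vs c))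
    {0..vs ! 0}"
proof (cases n)
  case 0
  have "comps (Suc 0) 0 = {[0]}"
    by (auto simp: comps_def length_Suc_conv)
  moreover have "comps (Suc (Suc 0)) (Suc 0) = {[0, 1], [1, 0]}"
    by (auto simp: comps_def length_Suc_conv add_is_1)
  moreover obtain x y where vs: "vs = [x, y]"
    using assms 0 by (auto simp: length_Suc_conv)
  moreover have "cmerge 0 0 [Suc 0, 0] = [0]"
    by (simp add: cmerge_def)
  moreover have "dmonom (cmerge (x - r) r [x, y]) [0] = 1" for r
    by (simp add: cmerge_def)
  ultimately show ?thesis
    using assms 0 has_integral_const_real[of "G [0]" 0 x] by (simp add: dpow_def mult.commute)
next
  case (Suc m)
  obtain v0 v1 ms vn where vs: "vs = v0 # v1 # ms @ [vn]" and lm: "length ms = m"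
    using assms Suc by (auto elim: length_Suc_Suc_Suc_snocE)
  let ?C' = "comps (Suc n) n" and ?C = "comps (Suc (Suc n)) (Suc n)"
  \<comment> \<open>\<open>T\<close> is one term of the expansion and \<open>T'\<close> its
    integral: \<open>j\<close> is the power of \<open>v0 - r\<close> split off at the successor,
    \<open>i\<close> the power of \<open>r\<close> split off at the predecessor.\<close>
  define T where "T = (\<lambda>(c, j, i) r. G c * (dpow r i * dpow (v0 - r) j) *
      (dpow v1 (hd c - j) * dmonom ms (butlast (tl c)) * dpow vn (last c - i)))"
  define T' where "T' = (\<lambda>(c, j, i). G c * dpow v0 (Suc (i + j)) *
      (dpow v1 (hd c - j) * dmonom ms (butlast (tl c)) * dpow vn (last c - i)))"
  have C': "\<exists>b ds z. c = b # ds @ [z] \<and> length ds = m" if "c \<in> ?C'" for c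
    using that Suc by (auto simp: comps_def elim: length_Suc_Suc_snocE)
  have "((\<lambda>r. \<Sum>p\<in>(SIGMA c:?C'. {..hd c} \<times> {..last c}). T p r) has_integral
      (\<Sum>p\<in>(SIGMA c:?C'. {..hd c} \<times> {..last c}). T' p)) {0..v0}"
  proof (intro has_integral_sum)
    fix p assume "p \<in> (SIGMA c:?C'. {..hd c} \<times> {..last c})"
    obtain c j i where p: "p = (c, j, i)"
      using prod_cases3 by blast
    show "(T p has_integral T' p) {0..v0}"
      unfolding p T_def T'_def prod.case using assms vs
      by (intro has_integral_mult_left has_integral_mult_right has_integral_dpow_beta) auto
  qed (auto simp: finite_comps)
  moreover have "(\<Sum>p\<in>(SIGMA c:?C'. {..hd c} \<times> {..last c}). T p r) =
      (\<Sum>c\<in>?C'. G c * dmonom (cmerge (vs ! 0 - r) r vs) c)" for r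
  proof -
    have "(\<Sum>p\<in>(SIGMA c:?C'. {..hd c} \<times> {..last c}). T p r) =
        (\<Sum>c\<in>?C'. \<Sum>q\<in>{..hd c} \<times> {..last c}. T (c, q) r)"
      by (subst sum.Sigma) (auto simp: finite_comps)
    also have "\<dots> = (\<Sum>c\<in>?C'. G c * dmonom (cmerge (vs ! 0 - r) r vs) c)"
    proof (rule sum.cong[OF refl])
      fix c assume "c \<in> ?C'"
      then obtain b ds z where c: "c = b # ds @ [z]" "length ds = m"
        using C' by blast
      have "(\<Sum>q\<in>{..hd c} \<times> {..last c}. T (c, q) r) = (\<Sum>j\<le>b. \<Sum>i\<le>z. T (c, j, i) r)"
        by (simp add: c sum.cartesian_product)
      also have "\<dots> = G c * (\<Sum>j\<le>b. dpow (v0 - r) j * dpow v1 (b - j)) *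
          (\<Sum>i\<le>z. dpow r i * dpow vn (z - i)) * dmonom ms ds"
        by (simp add: T_def c sum_distrib_left sum_distrib_right mult_ac)
      also have "\<dots> = G c * dmonom (cmerge (vs ! 0 - r) r vs) c"
        using c lm by (simp add: vs cmerge_snoc flip: dpow_add) (simp add: algebra_simps)
      finally show "(\<Sum>q\<in>{..hd c} \<times> {..last c}. T (c, q) r) =
          G c * dmonom (cmerge (vs ! 0 - r) r vs) c" .
    qed
    finally show ?thesis .
  qed
  moreover have "(\<Sum>p\<in>(SIGMA c:?C'. {..hd c} \<times> {..last c}). T' p) =
      (\<Sum>c\<in>?C. (\<Sum>i<c ! 0. G (cmerge (c ! 0 - Suc i) i c)) * dmonom vs c)"
  proof -
    have "(\<Sum>p\<in>(SIGMA c:?C'. {..hd c} \<times> {..last c}). T' p) =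
        (\<Sum>(c, i)\<in>(SIGMA c:?C. {..<c ! 0}). G (cmerge (c ! 0 - Suc i) i c) * dmonom vs c)"
    \<comment> \<open>A term corresponds to an exponent sequence with head \<open>i + j + 1\<close>,
      together with \<open>i\<close>: the portions \<open>j\<close> and \<open>i\<close> are taken
      off the two ends of \<open>c\<close>, and \<open>cmerge\<close> puts them back.\<close>
    proof (rule sum.reindex_bij_witness[where
          j = "\<lambda>(c, j, i). (Suc (i + j) # (hd c - j) # butlast (tl c) @ [last c - i], i)" and
          i = "\<lambda>(c, i). (cmerge (c ! 0 - Suc i) i c, c ! 0 - Suc i, i)"], goal_cases)
      case (1 p)
      then obtain c j i where p: "p = (c, j, i)" "c \<in> ?C'" "j \<le> hd c" "i \<le> last c"
        by auto
      then show ?case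
        using C'[of c] by (auto simp: cmerge_snoc)
    next
      case (2 p)
      then obtain c j i where p: "p = (c, j, i)" "c \<in> ?C'" "j \<le> hd c" "i \<le> last c"
        by auto
      then show ?case
        using C'[of c] by (auto simp: comps_def)
    next
      case (3 p)
      then obtain c i where p: "p = (c, i)" "c \<in> ?C" "i < c ! 0"
        by auto
      moreover from this obtain a b ds z where "c = a # b # ds @ [z]"
        using Suc by (auto simp: comps_def elim: length_Suc_Suc_Suc_snocE)
      ultimately show ?case
        by (auto simp: cmerge_snoc)
    next
      case (4 p)
      then obtain c i where p: "p = (c, i)" "c \<in> ?C" "i < c ! 0"
        by auto
      moreover from this obtain a b ds z where "c = a # b # ds @ [z]"
        using Suc by (auto simp: comps_def elim: length_Suc_Suc_Suc_snocE)
      ultimately show ?case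
        by (auto simp: cmerge_snoc comps_def)
    next
      case (5 p)
      then obtain c j i where p: "p = (c, j, i)" "c \<in> ?C'" "j \<le> hd c" "i \<le> last c"
        by auto
      then show ?case
        using C'[of c] lm by (auto simp: T'_def vs cmerge_snoc)
    qed
    also have "\<dots> = (\<Sum>c\<in>?C. \<Sum>i<c ! 0. G (cmerge (c ! 0 - Suc i) i c) * dmonom vs c)"
      by (subst sum.Sigma) (auto simp: finite_comps)
    finally show ?thesis
      by (simp add: sum_distrib_right)
  qed
  ultimately show ?thesis
    by (simp add: vs)
qed

section \<open>Volume by slicing\<close>

lemma bij_betw_rotate_comps: "bij_betw (rotate k) (comps m d) (comps m d)"
proof -
  have "inj (rotate k :: nat list \<Rightarrow> nat list)"
    unfolding rotate_def using inj_rotate1 by (rule inj_fn)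
  then have "inj_on (rotate k) (comps m d)"
    by (rule inj_on_subset) simp
  moreover have "rotate k ` comps m d \<subseteq> comps m d"
    by (auto simp: comps_def sum_list_rotate)
  ultimately show ?thesis
    by (simp add: bij_betw_def finite_comps endo_inj_surj)
qed

text \<open>
  The last entry of \<open>vs\<close> is a dummy: the coefficients with a positive last exponent vanish. Keeping
  it makes the slicing recursion uniform in the removed position.
\<close>

definition vol_poly :: "nat \<Rightarrow> real list \<Rightarrow> real" where
  "vol_poly n vs = (\<Sum>c\<in>comps (Suc n) n. real (cyc_eulerian n c) * dmonom vs c)"

lemma dmonom_nonneg:
  assumes "\<forall>x\<in>set xs. 0 \<le> x"
  shows "0 \<le> dmonom xs c"
  unfolding dmonom_def using assms
  by (intro prod_list_nonneg) (auto simp: dpow_def dest!: set_zip_leftD)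

lemma vol_poly_nonneg: "\<forall>x\<in>set vs. 0 \<le> x \<Longrightarrow> 0 \<le> vol_poly n vs"
  unfolding vol_poly_def by (intro sum_nonneg mult_nonneg_nonneg dmonom_nonneg) auto

text \<open>Rotation by \<open>k\<close> reduces this to a removed head: monomials keep their value
  when parameters and exponents rotate together, and rotating permutes the index set.\<close>

lemma has_integral_vol_poly_cmerge:
  assumes "length vs = Suc (Suc n)" "k \<le> n" "0 \<le> vs ! k"
  shows "((\<lambda>r. vol_poly n (rotate (Suc n - k) (cmerge (vs ! k - r) r (rotate k vs)))) has_integral
    (\<Sum>c\<in>comps (Suc (Suc n)) (Suc n). (\<Sum>i<c ! k. real (cyc_eulerian n (rotate (Suc n - k)
      (cmerge (c ! k - Suc i) i (rotate k c))))) * dmonom vs c)) {0..vs ! k}"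
proof -
  define G where "G c = real (cyc_eulerian n (rotate (Suc n - k) c))" for c
  have hd: "rotate k vs ! 0 = vs ! k"
    using assms by (simp add: nth_rotate)
  have "vol_poly n (rotate (Suc n - k) (cmerge (vs ! k - r) r (rotate k vs))) =
      (\<Sum>c\<in>comps (Suc n) n. G c * dmonom (cmerge (vs ! k - r) r (rotate k vs)) c)" for r
  proof -
    have "(\<Sum>c\<in>comps (Suc n) n. G c * dmonom (cmerge (vs ! k - r) r (rotate k vs)) c) =
      (\<Sum>c\<in>comps (Suc n) n. real (cyc_eulerian n (rotate (Suc n - k) c)) *
        dmonom (rotate (Suc n - k) (cmerge (vs ! k - r) r (rotate k vs))) (rotate (Suc n - k) c))"
      using assms by (intro sum.cong refl) (simp add: comps_def dmonom_rotate G_def)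
    also have "\<dots> = vol_poly n (rotate (Suc n - k) (cmerge (vs ! k - r) r (rotate k vs)))"
      unfolding vol_poly_def by (rule sum.reindex_bij_betw[OF bij_betw_rotate_comps])
    finally show ?thesis
      by simp
  qed
  moreover have "(\<Sum>c\<in>comps (Suc (Suc n)) (Suc n).
        (\<Sum>i<c ! 0. G (cmerge (c ! 0 - Suc i) i c)) * dmonom (rotate k vs) c) =
      (\<Sum>c\<in>comps (Suc (Suc n)) (Suc n). (\<Sum>i<c ! k. real (cyc_eulerian n (rotate (Suc n - k)
        (cmerge (c ! k - Suc i) i (rotate k c))))) * dmonom vs c)"
  proof -
    have "rotate k c ! 0 = c ! k" if "c \<in> comps (Suc (Suc n)) (Suc n)" for c
      using assms that by (simp add: nth_rotate comps_def)
    then have "(\<Sum>c\<in>comps (Suc (Suc n)) (Suc n). (\<Sum>i<c ! k. real (cyc_eulerian n (rotate (Suc n - k)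
        (cmerge (c ! k - Suc i) i (rotate k c))))) * dmonom vs c) =
      (\<Sum>c\<in>comps (Suc (Suc n)) (Suc n). (\<Sum>i<rotate k c ! 0.
        G (cmerge (rotate k c ! 0 - Suc i) i (rotate k c))) * dmonom (rotate k vs) (rotate k c))"
      using assms by (intro sum.cong refl) (simp add: comps_def dmonom_rotate G_def)
    also have "\<dots> = (\<Sum>c\<in>comps (Suc (Suc n)) (Suc n).
        (\<Sum>i<c ! 0. G (cmerge (c ! 0 - Suc i) i c)) * dmonom (rotate k vs) c)"
      by (rule sum.reindex_bij_betw[OF bij_betw_rotate_comps])
    finally show ?thesis
      by simp
  qed
  ultimately show ?thesis
    using has_integral_dmonom_cmerge[of "rotate k vs" n G] assms hd by simp
qed

text \<open>
  The projection along the last coordinate of the polytope of all $t \in \mathbb{R}^{n+1}$ with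
  $\sum_{i \in I} t_i \le f(|I|)$ for all \<open>I\<close>, with equality for $I = \{1, \dots, n+1\}$. The lower
  bounds come from the sets that contain $n + 1$.
\<close>

definition base_polytope :: "nat \<Rightarrow> (nat \<Rightarrow> real) \<Rightarrow> (nat \<Rightarrow> real) set" where
  "base_polytope n f = {t \<in> {1..n} \<rightarrow>\<^sub>E UNIV. \<forall>I\<in>Pow {1..n}.
     f (Suc n) - f (Suc n - card I) \<le> sum t I \<and> sum t I \<le> f (card I)}"

lemma sets_base_polytope: "base_polytope n f \<in> sets (\<Pi>\<^sub>M i\<in>{1..n}. lborel)"
proof -
  have "base_polytope n f = {t \<in> space (\<Pi>\<^sub>M i\<in>{1..n}. lborel). \<forall>I\<in>Pow {1..n}.
     f (Suc n) - f (Suc n - card I) \<le> sum t I \<and> sum t I \<le> f (card I)}"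
    by (simp add: base_polytope_def space_PiM)
  also have "\<dots> \<in> sets (\<Pi>\<^sub>M i\<in>{1..n}. lborel)"
  proof (rule sets.sets_Collect_finite_All)
    fix I assume "I \<in> Pow {1..n}"
    then have [measurable]: "(\<lambda>t. sum t I) \<in> borel_measurable (\<Pi>\<^sub>M i\<in>{1..n}. lborel)"
      by (intro borel_measurable_sum) auto
    show "{t \<in> space (\<Pi>\<^sub>M i\<in>{1..n}. lborel).
        f (Suc n) - f (Suc n - card I) \<le> sum t I \<and> sum t I \<le> f (card I)}
        \<in> sets (\<Pi>\<^sub>M i\<in>{1..n}. lborel)"
      by measurable
  qed simp
  finally show ?thesis .
qed

text \<open>A set \<open>I\<close> and \<open>insert (Suc n) I\<close> bound \<open>sum t I\<close>
  from above by \<open>f (card I)\<close> and \<open>f (Suc (card I)) - s\<close>, whence the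
  minimum.\<close>

lemma base_polytope_slice:
  assumes "f 0 = 0" "t \<in> {1..n} \<rightarrow>\<^sub>E UNIV"
  shows "t(Suc n := s) \<in> base_polytope (Suc n) f \<longleftrightarrow>
    s \<in> {f (Suc (Suc n)) - f (Suc n)..f 1} \<and> t \<in> base_polytope n (\<lambda>j. min (f j) (f (Suc j) - s))"
proof -
  let ?B = "\<lambda>I. f (Suc (Suc n)) - f (Suc (Suc n) - card I) \<le> sum t I \<and> sum t I \<le> f (card I) \<and>
    f (Suc (Suc n)) - f (Suc n - card I) \<le> sum t I + s \<and> sum t I + s \<le> f (Suc (card I))"
  have "t(Suc n := s) \<in> base_polytope (Suc n) f \<longleftrightarrow>
      (\<forall>I\<in>Pow (insert (Suc n) {1..n}). f (Suc (Suc n)) - f (Suc (Suc n) - card I) \<le>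
        sum (t(Suc n := s)) I \<and> sum (t(Suc n := s)) I \<le> f (card I))"
    using assms by (auto simp: base_polytope_def atLeastAtMostSuc_conv PiE_iff extensional_def)
  also have "\<dots> \<longleftrightarrow> (\<forall>I\<in>Pow {1..n}. ?B I)"
  proof -
    have "sum (t(Suc n := s)) I = sum t I"
      "sum (t(Suc n := s)) (insert (Suc n) I) = sum t I + s"
      "card (insert (Suc n) I) = Suc (card I)"
      if "I \<in> Pow {1..n}" for I
    proof -
      have I: "finite I" "Suc n \<notin> I"
        using that by (auto intro: finite_subset)
      then show "sum (t(Suc n := s)) I = sum t I" "card (insert (Suc n) I) = Suc (card I)"
        by (auto intro!: sum.cong)
      then show "sum (t(Suc n := s)) (insert (Suc n) I) = sum t I + s"
        using I by simp
    qed
    then show ?thesis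
      unfolding Pow_insert by (simp add: ball_Un conj_assoc ball_conj_distrib) blast
  qed
  \<comment> \<open>The bounds on \<open>s\<close> are the case \<open>I = {}\<close>.\<close>
  also have "\<dots> \<longleftrightarrow> s \<in> {f (Suc (Suc n)) - f (Suc n)..f 1} \<and> (\<forall>I\<in>Pow {1..n}. ?B I)"
    using assms(1) by force
  also have "\<dots> \<longleftrightarrow> s \<in> {f (Suc (Suc n)) - f (Suc n)..f 1} \<and>
      t \<in> base_polytope n (\<lambda>j. min (f j) (f (Suc j) - s))"
  proof (rule conj_cong[OF refl])
    assume s: "s \<in> {f (Suc (Suc n)) - f (Suc n)..f 1}"
    \<comment> \<open>For such \<open>s\<close> the minimum at \<open>Suc n\<close> is
      \<open>f (Suc (Suc n)) - s\<close>, so the two lower bounds also combine into one.\<close>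
    have "?B I \<longleftrightarrow> min (f (Suc n)) (f (Suc (Suc n)) - s) -
        min (f (Suc n - card I)) (f (Suc (Suc n - card I)) - s) \<le> sum t I \<and>
        sum t I \<le> min (f (card I)) (f (Suc (card I)) - s)" if "I \<in> Pow {1..n}" for I
    proof -
      have "card I \<le> n"
        using card_mono[of "{1..n}" I] that by auto
      then have "Suc (Suc n) - card I = Suc (Suc n - card I)"
        by simp
      then show ?thesis
        using s by (auto simp: min_def)
    qed
    then show "(\<forall>I\<in>Pow {1..n}. ?B I) \<longleftrightarrow> t \<in> base_polytope n (\<lambda>j. min (f j) (f (Suc j) - s))"
      using assms(2) by (simp add: base_polytope_def)
  qed
  finally show ?thesis .
qed

text \<open>Tonelli's theorem with the coordinate \<open>Suc n\<close> outermost.\<close>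

lemma emeasure_base_polytope_Suc:
  assumes "f 0 = 0"
  shows "emeasure (\<Pi>\<^sub>M i\<in>{1..Suc n}. lborel) (base_polytope (Suc n) f) =
    (\<integral>\<^sup>+s. emeasure (\<Pi>\<^sub>M i\<in>{1..n}. lborel) (base_polytope n (\<lambda>j. min (f j) (f (Suc j) - s))) *
      indicator {f (Suc (Suc n)) - f (Suc n)..f 1} s \<partial>lborel)"
proof -
  interpret product_sigma_finite "\<lambda>_::nat. lborel :: real measure"
    by standard
  have ins: "{1..Suc n} = insert (Suc n) {1..n}"
    by auto
  have "emeasure (\<Pi>\<^sub>M i\<in>{1..Suc n}. lborel) (base_polytope (Suc n) f) =
      (\<integral>\<^sup>+t. indicator (base_polytope (Suc n) f) t \<partial>(\<Pi>\<^sub>M i\<in>{1..Suc n}. lborel))"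
    by (rule nn_integral_indicator[OF sets_base_polytope, symmetric])
  also have "\<dots> = (\<integral>\<^sup>+s. (\<integral>\<^sup>+t. indicator (base_polytope (Suc n) f) (t(Suc n := s))
      \<partial>(\<Pi>\<^sub>M i\<in>{1..n}. lborel)) \<partial>lborel)"
    using borel_measurable_indicator[OF sets_base_polytope[of "Suc n" f]] unfolding ins
    by (intro product_nn_integral_insert_rev) auto
  also have "\<dots> = (\<integral>\<^sup>+s. (\<integral>\<^sup>+t. indicator (base_polytope n (\<lambda>j. min (f j) (f (Suc j) - s))) t *
      indicator {f (Suc (Suc n)) - f (Suc n)..f 1} s \<partial>(\<Pi>\<^sub>M i\<in>{1..n}. lborel)) \<partial>lborel)"
    using assms
    by (intro nn_integral_cong) (auto simp: space_PiM base_polytope_slice indicator_def)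
  also have "\<dots> = (\<integral>\<^sup>+s. emeasure (\<Pi>\<^sub>M i\<in>{1..n}. lborel) (base_polytope n (\<lambda>j. min (f j) (f (Suc j) - s))) *
      indicator {f (Suc (Suc n)) - f (Suc n)..f 1} s \<partial>lborel)"
    by (simp only: nn_integral_multc[OF borel_measurable_indicator[OF sets_base_polytope]]
        nn_integral_indicator[OF sets_base_polytope])
  finally show ?thesis .
qed

text \<open>
  For $f(j) = \sum_k u_k \min(k, j)$, which describes $\sum_k u_k \Delta_{k,n+1}$, the negated second
  differences recover the parameters: \<open>kink f k\<close> is $u_{k+1}$.
\<close>

definition kink :: "(nat \<Rightarrow> real) \<Rightarrow> nat \<Rightarrow> real" where
  "kink f k = 2 * f (Suc k) - f k - f (Suc (Suc k))"

section \<open>Concave functions and the volume by induction on the dimension\<close>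

lemma ex_consecutive_interval:
  fixes X :: "nat \<Rightarrow> 'a::linorder"
  assumes "X (Suc n) \<le> s" "s \<le> X 0"
  shows "\<exists>k\<le>n. s \<in> {X (Suc k)..X k}"
  using assms(1)
proof (induction n)
  case (Suc n)
  then show ?case
    by (cases "X (Suc n) \<le> s") (auto intro: le_SucI)
qed (use assms(2) in auto)

text \<open>\<open>kink f k\<close> is the drop between the slopes at \<open>k\<close> and
  \<open>Suc k\<close>, so nonnegative kinks mean concavity.\<close>

lemma slope_antimono:
  assumes "\<forall>k<n. 0 \<le> kink f k" "i \<le> j" "j \<le> n"
  shows "f (Suc j) - f j \<le> f (Suc i) - f i"
  using assms(2,3)
proof (induction j rule: dec_induct)
  case (step j)
  then have "0 \<le> kink f j"
    using assms(1) by auto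
  then show ?case
    using step by (simp add: kink_def)
qed simp

text \<open>\<open>f j \<le> f (Suc j) - s\<close> says that the slope at \<open>j\<close> is at
  least \<open>s\<close>. Slopes do not increase and \<open>s\<close> lies between those at
  \<open>Suc k\<close> and \<open>k\<close>, so the minimum changes branch once, after
  \<open>k\<close>.\<close>

lemma min_slice_eq:
  assumes "\<forall>k<Suc n. 0 \<le> kink f k" "k \<le> n" "j \<le> Suc n"
    and "s \<in> {f (Suc (Suc k)) - f (Suc k)..f (Suc k) - f k}"
  shows "min (f j) (f (Suc j) - s) = (if j \<le> k then f j else f (Suc j) - s)"
  using slope_antimono[OF assms(1), of j k] slope_antimono[OF assms(1), of "Suc k" j] assms(2-4)
  by (auto simp: min_def)

text \<open>The change of branch splits kink \<open>k\<close> into the shares \<open>r\<close>,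
  added to kink \<open>k - 1\<close>, and \<open>kink f k - r\<close>, added to kink
  \<open>k + 1\<close>, just as \<open>cmerge\<close> does. Shares beyond either end fall on the
  dummy entry, whence the unspecified \<open>w'\<close>.\<close>

lemma kink_slice:
  assumes "\<forall>k<Suc n. 0 \<le> kink f k" "k \<le> n"
    and "s \<in> {f (Suc (Suc k)) - f (Suc k)..f (Suc k) - f k}"
    and "r = s - (f (Suc (Suc k)) - f (Suc k))"
    and "vs = map (kink f) [0..<Suc n] @ [w]"
  shows "\<exists>w'. rotate (Suc n - k) (cmerge (vs ! k - r) r (rotate k vs)) =
    map (kink (\<lambda>j. min (f j) (f (Suc j) - s))) [0..<n] @ [w']"
proof -
  let ?L = "rotate (Suc n - k) (cmerge (vs ! k - r) r (rotate k vs))"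
  have len: "length vs = Suc (Suc n)"
    using assms by simp
  have vs: "vs ! p = kink f p" if "p \<le> n" for p
    using assms that by (auto simp: nth_append simp del: upt_Suc)
  have "?L ! p = kink (\<lambda>j. min (f j) (f (Suc j) - s)) p" if "p < n" for p
  proof -
    have "?L ! p = (if p < k then vs ! p else vs ! Suc p) + (if p = k then vs ! k - r else 0) +
        (if Suc p = k \<or> (k = 0 \<and> p = n) then r else 0)"
      using len assms(2) that by (intro nth_rotate_cmerge) auto
    moreover have "kink (\<lambda>j. min (f j) (f (Suc j) - s)) p =
        2 * (if Suc p \<le> k then f (Suc p) else f (Suc (Suc p)) - s) -
        (if p \<le> k then f p else f (Suc p) - s) -
        (if Suc (Suc p) \<le> k then f (Suc (Suc p)) else f (Suc (Suc (Suc p))) - s)"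
      unfolding kink_def using that assms(2)
      by (simp add: min_slice_eq[OF assms(1,2) _ assms(3)])
    ultimately show ?thesis
      using that assms(2) vs[of p] vs[of "Suc p"] vs[of k]
      by (auto simp: kink_def assms(4) split: if_splits)
  qed
  then have "?L = map (kink (\<lambda>j. min (f j) (f (Suc j) - s))) [0..<n] @ [?L ! n]"
    using len by (intro nth_equalityI) (auto simp: nth_append less_Suc_eq)
  then show ?thesis
    by blast
qed

text \<open>Induction on the dimension, integrating over slices. The dummy \<open>w\<close> is
  arbitrary because slicing can alter it.\<close>

lemma emeasure_base_polytope:
  assumes "f 0 = 0" "\<forall>k<n. 0 \<le> kink f k" "0 \<le> w"
  shows "emeasure (\<Pi>\<^sub>M i\<in>{1..n}. lborel) (base_polytope n f) =
    ennreal (vol_poly n (map (kink f) [0..<n] @ [w]))"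
  using assms
proof (induction n arbitrary: f w)
  case 0
  have "base_polytope 0 f = {\<lambda>_. undefined}"
    using 0 by (auto simp: base_polytope_def)
  moreover have "comps (Suc 0) 0 = {[0]}"
    by (auto simp: comps_def length_Suc_conv)
  moreover have "emeasure (PiM {} (\<lambda>_::nat. lborel :: real measure)) {\<lambda>_. undefined} = 1"
    by (simp add: PiM_empty)
  ultimately show ?case
    by (simp add: vol_poly_def)
next
  case (Suc n)
  define vs where "vs = map (kink f) [0..<Suc n] @ [w]"
  \<comment> \<open>The slopes cut the range of the sliced coordinate into the intervals from
    \<open>X (Suc k)\<close> to \<open>X k\<close>, of length \<open>vs ! k\<close>.\<close>
  define X where "X k = f (Suc k) - f k" for k
  define h where "h s = measure (\<Pi>\<^sub>M i\<in>{1..n}. lborel) (base_polytope n (\<lambda>j. min (f j) (f (Suc j) - s)))" for s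
  define P where "P k = (\<Sum>c\<in>comps (Suc (Suc n)) (Suc n). (\<Sum>i<c ! k. real (cyc_eulerian n
      (rotate (Suc n - k) (cmerge (c ! k - Suc i) i (rotate k c))))) * dmonom vs c)" for k
  note concave = Suc.prems(2)
  have len: "length vs = Suc (Suc n)"
    by (simp add: vs_def)
  have vs_k: "vs ! k = X k - X (Suc k)" "0 \<le> vs ! k" if "k \<le> n" for k
    using that Suc.prems(2) by (auto simp: vs_def nth_append X_def kink_def simp del: upt_Suc)
  have vs_nonneg: "\<forall>x\<in>set vs. 0 \<le> x"
    using Suc.prems by (auto simp: vs_def)
  \<comment> \<open>On interval \<open>k\<close> the kinks of the slice are the merged parameters,
    so the induction hypothesis applies.\<close>
  have slice: "emeasure (\<Pi>\<^sub>M i\<in>{1..n}. lborel) (base_polytope n (\<lambda>j. min (f j) (f (Suc j) - s))) =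
      ennreal (vol_poly n (rotate (Suc n - k) (cmerge (vs ! k - (s - X (Suc k))) (s - X (Suc k))
        (rotate k vs))))"
    "h s = vol_poly n (rotate (Suc n - k) (cmerge (vs ! k - (s - X (Suc k))) (s - X (Suc k))
        (rotate k vs)))"
    if "k \<le> n" "s \<in> {X (Suc k)..X k}" for k s
  proof -
    let ?f = "\<lambda>j. min (f j) (f (Suc j) - s)"
    let ?L = "rotate (Suc n - k) (cmerge (vs ! k - (s - X (Suc k))) (s - X (Suc k)) (rotate k vs))"
    have s: "s \<in> {f (Suc (Suc k)) - f (Suc k)..f (Suc k) - f k}"
      using that by (simp add: X_def)
    obtain w' where w': "?L = map (kink ?f) [0..<n] @ [w']"
      using kink_slice[OF Suc.prems(2) \<open>k \<le> n\<close> s, of "s - X (Suc k)" vs w] vs_def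
      unfolding X_def by blast
    have "0 \<le> vs ! k - (s - X (Suc k))" "0 \<le> s - X (Suc k)"
      using that vs_k(1)[of k] by auto
    then have L: "\<forall>x\<in>set ?L. 0 \<le> x"
      using vs_nonneg len that
      by (auto simp: cmerge_def set_conv_nth[of vs] intro!: add_nonneg_nonneg simp del: upt_Suc)
        (use vs_nonneg len in \<open>auto simp: nth_rotate all_set_conv_all_nth\<close>)
    have "X 0 \<ge> s"
      using that slope_antimono[OF Suc.prems(2), of 0 k] by (auto simp: X_def)
    then have "?f 0 = 0"
      using Suc.prems(1) by (simp add: X_def)
    then have e: "emeasure (\<Pi>\<^sub>M i\<in>{1..n}. lborel) (base_polytope n ?f) = ennreal (vol_poly n ?L)"
      unfolding w' using L unfolding w' by (intro Suc.IH) auto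
    then show "emeasure (\<Pi>\<^sub>M i\<in>{1..n}. lborel) (base_polytope n ?f) = ennreal (vol_poly n ?L)"
      "h s = vol_poly n ?L"
      using vol_poly_nonneg[OF L] by (simp_all add: h_def measure_def)
  qed
  have piece: "(h has_integral P k) {X (Suc k)..X k}" if "k \<le> n" for k
  proof -
    have "((\<lambda>r. vol_poly n (rotate (Suc n - k) (cmerge (vs ! k - r) r (rotate k vs))))
        has_integral P k) {0..vs ! k}"
      unfolding P_def using len that vs_k(2)[of k] by (intro has_integral_vol_poly_cmerge)
    \<comment> \<open>Substitution \<open>r = s - X (Suc k)\<close>.\<close>
    then have "((\<lambda>s. vol_poly n (rotate (Suc n - k)
        (cmerge (vs ! k - (s - X (Suc k))) (s - X (Suc k)) (rotate k vs)))) has_integral P k)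
        {X (Suc k)..X k}"
      using has_integral_shift_real_ivl_iff[of "\<lambda>s. vol_poly n (rotate (Suc n - k)
        (cmerge (vs ! k - s) s (rotate k vs)))" "P k" 0 "vs ! k" "- X (Suc k)"] that vs_k(1)[of k]
      by (simp add: algebra_simps)
    then show ?thesis
      by (rule has_integral_eq[rotated]) (simp add: slice(2)[OF that])
  qed
  have "(h has_integral (\<Sum>k<m. P k)) {X m..X 0}" if "m \<le> Suc n" for m
    using that
  proof (induction m)
    case 0
    then show ?case
      using has_integral_refl(2)[of h "X 0"] by simp
  next
    case (Suc m)
    have "X (Suc m) \<le> X m" "X m \<le> X 0"
      using Suc.prems vs_k[of m] slope_antimono[OF concave, of 0 m] by (auto simp: X_def)
    then show ?case
      using has_integral_combine[OF _ _ piece[of m] Suc.IH] Suc.prems by (simp add: add.commute)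
  qed
  from this[of "Suc n"] have I: "(h has_integral (\<Sum>k<Suc n. P k)) {X (Suc n)..X 0}"
    by simp
  have em: "emeasure (\<Pi>\<^sub>M i\<in>{1..n}. lborel) (base_polytope n (\<lambda>j. min (f j) (f (Suc j) - s))) = ennreal (h s)"
    if "s \<in> {X (Suc n)..X 0}" for s
    using that slice ex_consecutive_interval[of X n s] by fastforce
  have "emeasure (\<Pi>\<^sub>M i\<in>{1..Suc n}. lborel) (base_polytope (Suc n) f) =
      (\<integral>\<^sup>+s. ennreal (h s) * indicator {X (Suc n)..X 0} s \<partial>lborel)"
    unfolding emeasure_base_polytope_Suc[of f n, OF Suc.prems(1)] using em Suc.prems(1)
    by (intro nn_integral_cong) (auto simp: X_def indicator_def)
  also have "\<dots> = ennreal (\<Sum>k<Suc n. P k)"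
    by (rule nn_integral_has_integral_lebesgue'[OF _ I]) (simp add: h_def)
  \<comment> \<open>Exchanging the sums turns the pieces into the recursion of
    \<open>cyc_eulerian\<close>.\<close>
  also have "(\<Sum>k<Suc n. P k) = vol_poly (Suc n) vs"
    unfolding P_def vol_poly_def
    by (subst sum.swap) (simp add: sum_distrib_right del: sum.lessThan_Suc)
  finally show ?case
    by (simp add: vs_def)
qed

section \<open>Minkowski sums of hypersimplices\<close>

text \<open>The three conditions cut out a convex set \<open>?Q\<close> that contains the vertices,
  hence also their hull.\<close>

lemma hypersimplexD:
  assumes "y \<in> hypersimplex k m"
  shows "i \<notin> {1..m} \<Longrightarrow> y i = 0" "sum y {1..m} = real k"
    "I \<subseteq> {1..m} \<Longrightarrow> sum y I \<le> real (min k (card I))"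
proof -
  let ?V = "{t :: nat \<Rightarrow> real. (\<forall>i\<in>{1..m}. t i \<in> {0, 1}) \<and> (\<forall>i. i \<notin> {1..m} \<longrightarrow> t i = 0) \<and>
    card {i\<in>{1..m}. t i = 1} = k}"
  let ?Q = "{y :: nat \<Rightarrow> real. (\<forall>i. i \<notin> {1..m} \<longrightarrow> y i = 0) \<and> sum y {1..m} = real k \<and>
    (\<forall>I\<subseteq>{1..m}. sum y I \<le> real (min k (card I)))}"
  have "convex ?Q"
  proof (rule convexI)
    fix x y :: "nat \<Rightarrow> real" and a b :: real
    assume xy: "x \<in> ?Q" "y \<in> ?Q" and ab: "0 \<le> a" "0 \<le> b" "a + b = 1"
    have s: "sum (a *\<^sub>R x + b *\<^sub>R y) I = a * sum x I + b * sum y I" for I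
      by (simp add: scaleR_fun_def sum.distrib sum_distrib_left)
    have ab_c: "a * c + b * c = c" for c :: real
      using ab by (metis distrib_right mult_1)
    show "a *\<^sub>R x + b *\<^sub>R y \<in> ?Q"
    proof (intro CollectI conjI allI impI)
      show "(a *\<^sub>R x + b *\<^sub>R y) i = 0" if "i \<notin> {1..m}" for i
        using xy that by (simp add: scaleR_fun_def)
      show "sum (a *\<^sub>R x + b *\<^sub>R y) {1..m} = real k"
        unfolding s using xy ab_c by simp
      show "sum (a *\<^sub>R x + b *\<^sub>R y) I \<le> real (min k (card I))" if "I \<subseteq> {1..m}" for I
      proof -
        have "a * sum x I + b * sum y I \<le> a * real (min k (card I)) + b * real (min k (card I))"
          using xy ab that by (intro add_mono mult_left_mono) blast+
        then show ?thesis
          unfolding s ab_c .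
      qed
    qed
  qed
  moreover have "?V \<subseteq> ?Q"
  proof
    fix t assume t: "t \<in> ?V"
    have sum: "sum t I = real (card {i\<in>I. t i = 1})" if "I \<subseteq> {1..m}" for I
    proof -
      have "finite I"
        using that finite_subset by blast
      have "sum t I = (\<Sum>i\<in>I. if t i = 1 then 1 else 0)"
        using t that by (intro sum.cong) auto
      then show ?thesis
        using \<open>finite I\<close> by (simp add: sum.If_cases Int_def)
    qed
    have "card {i\<in>I. t i = 1} \<le> min k (card I)" if "I \<subseteq> {1..m}" for I
    proof -
      have "finite I"
        using that finite_subset by blast
      then have "card {i\<in>I. t i = 1} \<le> card I"
        by (intro card_mono) auto
      moreover have "card {i\<in>I. t i = 1} \<le> card {i\<in>{1..m}. t i = 1}"
        using that by (intro card_mono) auto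
      ultimately show ?thesis
        using t by auto
    qed
    then have "\<forall>I\<subseteq>{1..m}. sum t I \<le> real (min k (card I))"
      using sum by (metis of_nat_mono)
    then show "t \<in> ?Q"
      using t sum[OF order_refl] by blast
  qed
  ultimately have "hypersimplex k m \<subseteq> ?Q"
    unfolding hypersimplex_def by (rule hull_minimal[rotated])
  then show "i \<notin> {1..m} \<Longrightarrow> y i = 0" "sum y {1..m} = real k"
    "I \<subseteq> {1..m} \<Longrightarrow> sum y I \<le> real (min k (card I))"
    using assms by auto
qed

text \<open>Vertices stay vertices when a coordinate 0 is added. With the next lemma, this lifts
  points of a slice to last coordinate 0 or 1.\<close>

lemma hypersimplex_Suc: "hypersimplex k m \<subseteq> hypersimplex k (Suc m)"
proof -
  have "{i\<in>{1..Suc m}. t i = 1} = {i\<in>{1..m}. t i = 1}" if "t (Suc m) = 0" for t :: "nat \<Rightarrow> real"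
    using that by (auto simp: le_Suc_eq)
  then show ?thesis
    unfolding hypersimplex_def by (intro hull_mono) (auto simp: atLeastAtMostSuc_conv)
qed

text \<open>A new coordinate 1 raises the number of ones by one, and translation commutes with the
  hull.\<close>

lemma hypersimplex_Suc_Suc:
  assumes "y \<in> hypersimplex k m"
  shows "(\<lambda>i. (if i = Suc m then 1 else 0)) + y \<in> hypersimplex (Suc k) (Suc m)"
proof -
  let ?V = "\<lambda>k m. {t :: nat \<Rightarrow> real. (\<forall>i\<in>{1..m}. t i \<in> {0, 1}) \<and> (\<forall>i. i \<notin> {1..m} \<longrightarrow> t i = 0) \<and>
    card {i\<in>{1..m}. t i = 1} = k}"
  let ?e = "\<lambda>i. (if i = Suc m then 1 else 0) :: real"
  have "(+) ?e ` ?V k m \<subseteq> ?V (Suc k) (Suc m)"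
  proof clarify
    fix t :: "nat \<Rightarrow> real"
    assume t: "\<forall>i\<in>{1..m}. t i \<in> {0, 1}" "\<forall>i. i \<notin> {1..m} \<longrightarrow> t i = 0"
      "k = card {i \<in> {1..m}. t i = 1}"
    have "{i \<in> {1..Suc m}. (?e + t) i = 1} = insert (Suc m) {i \<in> {1..m}. t i = 1}"
      using t(2) by auto
    then have "card {i \<in> {1..Suc m}. (?e + t) i = 1} = Suc (card {i \<in> {1..m}. t i = 1})"
      by simp
    then show "(\<forall>i\<in>{1..Suc m}. (?e + t) i \<in> {0, 1}) \<and> (\<forall>i. i \<notin> {1..Suc m} \<longrightarrow> (?e + t) i = 0) \<and>
        card {i \<in> {1..Suc m}. (?e + t) i = 1} = Suc (card {i \<in> {1..m}. t i = 1})"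
      using t(1,2) by auto
  qed
  then have "(+) ?e ` (convex hull ?V k m) \<subseteq> convex hull ?V (Suc k) (Suc m)"
    by (metis (no_types, lifting) convex_hull_translation hull_mono)
  then show ?thesis
    using assms unfolding hypersimplex_def by blast
qed

lemma zero_in_hypersimplex_0: "(\<lambda>_. 0) \<in> hypersimplex 0 m"
  unfolding hypersimplex_def by (rule hull_inc) auto

lemma sum_lessThan_Suc_skip:
  fixes g :: "nat \<Rightarrow> 'a::comm_monoid_add"
  assumes "k \<le> n"
  shows "(\<Sum>j<Suc n. g j) = g k + (\<Sum>p<n. if p < k then g p else g (Suc p))"
  using assms
proof (induction n)
  case (Suc n)
  show ?case
  proof (cases "k = Suc n")
    case True
    then show ?thesis
      by (simp add: add.commute)
  next
    case False
    with Suc show ?thesis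
      by (simp add: add_ac)
  qed
qed simp

text \<open>Telescoping of slopes. It evaluates the last coordinate of the summands after
  \<open>k\<close> in the decomposition.\<close>

lemma sum_kink_tail:
  "k \<le> n \<Longrightarrow> (\<Sum>p<n. if p < k then 0 else kink f (Suc p)) =
    (f (Suc (Suc k)) - f (Suc k)) - (f (Suc (Suc n)) - f (Suc n))"
proof (induction n)
  case (Suc n)
  show ?case
  proof (cases "k = Suc n")
    case False
    with Suc show ?thesis
      by (simp add: kink_def)
  qed simp
qed simp

text \<open>Convexity multiplied through by \<open>a\<close>, a form that covers
  \<open>a = 0\<close>.\<close>

lemma ex_hypersimplex_segment:
  assumes "0 \<le> r" "r \<le> a" "y \<in> hypersimplex k m" "y' \<in> hypersimplex k m"
  shows "\<exists>z\<in>hypersimplex k m. \<forall>i. a * z i = (a - r) * y i + r * y' i"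
proof (cases "a = 0")
  case True
  then show ?thesis
    using assms by (intro bexI[of _ y]) auto
next
  case False
  have "(1 - r / a) *\<^sub>R y + (r / a) *\<^sub>R y' \<in> hypersimplex k m"
    using assms False convex_convex_hull unfolding hypersimplex_def
    by (intro convexD) (auto simp: divide_simps)
  then show ?thesis
    using False by (intro bexI) (auto simp: scaleR_fun_def field_simps)
qed

text \<open>The last coordinate \<open>s\<close> of \<open>t\<close> picks a slope interval
  \<open>k\<close>, and the other coordinates decompose by induction for the slice. Lifting back,
  summands before \<open>k\<close> get last coordinate 0, those after \<open>k\<close> get 1, and
  summand \<open>k\<close> mixes the two with weights \<open>kink f k - r\<close> and
  \<open>r\<close>. The final hypersimplex is a single point, so \<open>kink f n\<close> may have
  any sign.\<close>

lemma hypersimplex_decomposition: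
  assumes "f 0 = 0" "\<forall>k<n. 0 \<le> kink f k" "f (Suc (Suc n)) = f (Suc n)"
    and "\<forall>i. i \<notin> {1..Suc n} \<longrightarrow> t i = 0"
    and "\<forall>I\<in>Pow {1..Suc n}. sum t I \<le> f (card I)" "sum t {1..Suc n} = f (Suc n)"
  shows "\<exists>y. (\<forall>k<Suc n. y k \<in> hypersimplex (Suc k) (Suc n)) \<and>
    (\<forall>i. t i = (\<Sum>k<Suc n. kink f k * y k i))"
  using assms
proof (induction n arbitrary: f t)
  case 0
  define y :: "nat \<Rightarrow> nat \<Rightarrow> real" where "y = (\<lambda>_ i. if i = 1 then 1 else 0)"
  have "y 0 \<in> hypersimplex (Suc 0) (Suc 0)"
    unfolding hypersimplex_def y_def by (rule hull_inc) (auto simp: Collect_conv_if)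
  moreover have "t i = kink f 0 * y 0 i" for i
    using 0 by (cases "i = 1") (auto simp: y_def kink_def)
  ultimately show ?case
    by (intro exI[of _ y]) auto
next
  case (Suc n)
  note f0 = Suc.prems(1) and concave = Suc.prems(2) and ft = Suc.prems(3) and supp = Suc.prems(4)
    and le = Suc.prems(5) and total = Suc.prems(6)
  let ?N = "Suc (Suc n)"
  define s where "s = t ?N"
  have ins: "{1..?N} = insert ?N {1..Suc n}"
    by auto
  have "sum t {1..Suc n} \<le> f (Suc n)" "s \<le> f 1"
    using le[rule_format, of "{1..Suc n}"] le[rule_format, of "{?N}"] by (auto simp: s_def)
  moreover have tot: "sum t {1..Suc n} + s = f ?N"
    using total by (simp add: s_def)
  \<comment> \<open>The lower bound on \<open>s\<close> is the total minus the bound for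
    \<open>{1..Suc n}\<close>.\<close>
  ultimately obtain k where k: "k \<le> n" and sk: "s \<in> {f (Suc (Suc k)) - f (Suc k)..f (Suc k) - f k}"
    using ex_consecutive_interval[of "\<lambda>k. f (Suc k) - f k" n s] f0 by auto
  define r where "r = s - (f (Suc (Suc k)) - f (Suc k))"
  have r: "0 \<le> r" "r \<le> kink f k"
    using sk by (auto simp: r_def kink_def)
  \<comment> \<open>The explicit form of the sliced minimum; the two agree up to
    \<open>Suc n\<close>, and the kinks of \<open>f'\<close> are explicit at every index.\<close>
  define f' where "f' j = (if j \<le> k then f j else f (Suc j) - s)" for j
  define t' where "t' = t(?N := 0)"
  have f'_min: "f' j = min (f j) (f (Suc j) - s)" if "j \<le> Suc n" for j
    using min_slice_eq[OF concave k that sk] by (simp add: f'_def)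
  have kink_f': "kink f' p = (if p < k then kink f p else kink f (Suc p)) +
      ((if p = k then kink f k - r else 0) + (if Suc p = k then r else 0))" for p
    by (auto simp: f'_def kink_def r_def)
  have sum_t': "sum t' I = sum t I" if "I \<subseteq> {1..Suc n}" for I
    using that unfolding t'_def by (intro sum.cong) auto
  have "\<exists>y. (\<forall>k<Suc n. y k \<in> hypersimplex (Suc k) (Suc n)) \<and>
      (\<forall>i. t' i = (\<Sum>k<Suc n. kink f' k * y k i))"
  proof (rule Suc.IH)
    show "f' 0 = 0"
      using f0 by (simp add: f'_def)
    show "\<forall>p<n. 0 \<le> kink f' p"
      using concave r by (auto simp: kink_f')
    show "f' (Suc (Suc n)) = f' (Suc n)"
      using k ft by (simp add: f'_def)
    show "\<forall>i. i \<notin> {1..Suc n} \<longrightarrow> t' i = 0"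
      using supp by (auto simp: t'_def le_Suc_eq)
    show "sum t' {1..Suc n} = f' (Suc n)"
      using tot k sum_t'[of "{1..Suc n}"] by (simp add: f'_def del: sum.cl_ivl_Suc)
    show "\<forall>I\<in>Pow {1..Suc n}. sum t' I \<le> f' (card I)"
    proof
      fix I assume I: "I \<in> Pow {1..Suc n}"
      then have fin: "finite I" "?N \<notin> I" and "card I \<le> Suc n"
        using card_mono[of "{1..Suc n}" I] by (auto intro: finite_subset)
      have "sum t I \<le> f (card I)" "sum t (insert ?N I) \<le> f (card (insert ?N I))"
        using le I unfolding ins by blast+
      then show "sum t' I \<le> f' (card I)"
        using fin I \<open>card I \<le> Suc n\<close> by (simp add: sum_t' f'_min s_def)
    qed
  qed
  then obtain y where y: "\<And>k. k < Suc n \<Longrightarrow> y k \<in> hypersimplex (Suc k) (Suc n)"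
    and t'_eq: "\<And>i. t' i = (\<Sum>k<Suc n. kink f' k * y k i)"
    by blast
  define e :: "nat \<Rightarrow> real" where "e = (\<lambda>i. if i = ?N then 1 else 0)"
  \<comment> \<open>For \<open>k = 0\<close> there is no preceding summand, and the zero vector
    takes its place.\<close>
  define y' where "y' = (if k = 0 then (\<lambda>_. 0) else y (k - 1))"
  have "y' \<in> hypersimplex k (Suc n)"
    using y[of "k - 1"] k by (auto simp: y'_def zero_in_hypersimplex_0)
  then have "e + y' \<in> hypersimplex (Suc k) ?N"
    unfolding e_def by (rule hypersimplex_Suc_Suc)
  then obtain zk where zk: "zk \<in> hypersimplex (Suc k) ?N"
    "\<And>i. kink f k * zk i = (kink f k - r) * y k i + r * (e i + y' i)"
    using ex_hypersimplex_segment[OF r, of "y k" "Suc k" ?N "e + y'"] y[of k] k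
      hypersimplex_Suc[of "Suc k" "Suc n"] by auto
  define z where "z j = (if j < k then y j else if j = k then zk else e + y (j - 1))" for j
  have "z j \<in> hypersimplex (Suc j) ?N" if "j < ?N" for j
  proof -
    have "e + y (j - 1) \<in> hypersimplex (Suc j) ?N" if "k < j"
      using hypersimplex_Suc_Suc[OF y[of "j - 1"]] that \<open>j < ?N\<close> by (simp add: e_def)
    then show ?thesis
      using y[of j] hypersimplex_Suc[of "Suc j" "Suc n"] zk(1) k by (auto simp: z_def)
  qed
  moreover have "t i = (\<Sum>j<?N. kink f j * z j i)" for i
  proof -
    have "(\<Sum>j<?N. kink f j * z j i) = kink f k * zk i +
        (\<Sum>p<Suc n. if p < k then kink f p * z p i else kink f (Suc p) * z (Suc p) i)"
      using k by (subst sum_lessThan_Suc_skip[of k]) (auto simp: z_def)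
    also have "(\<Sum>p<Suc n. if p < k then kink f p * z p i else kink f (Suc p) * z (Suc p) i) =
        (\<Sum>p<Suc n. (if p < k then kink f p else kink f (Suc p)) * y p i +
          (if p < k then 0 else kink f (Suc p)) * e i)"
      by (intro sum.cong) (auto simp: z_def algebra_simps)
    \<comment> \<open>The final slope is 0, so the summands after \<open>k\<close> contribute
      exactly the slope at \<open>Suc k\<close> to the last coordinate; adding \<open>r\<close>
      gives \<open>s\<close>.\<close>
    also have "\<dots> = (\<Sum>p<Suc n. (if p < k then kink f p else kink f (Suc p)) * y p i) +
        (f (Suc (Suc k)) - f (Suc k)) * e i"
      using k ft sum_kink_tail[of k "Suc n" f]
      by (simp add: sum.distrib flip: sum_distrib_right del: sum.lessThan_Suc)
    finally have z_eq: "(\<Sum>j<?N. kink f j * z j i) = (kink f k - r) * y k i + r * y' i + s * e i +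
        (\<Sum>p<Suc n. (if p < k then kink f p else kink f (Suc p)) * y p i)"
      by (simp only: zk(2)) (simp add: r_def algebra_simps del: sum.lessThan_Suc)
    have "(\<Sum>p<Suc n. (if p = k then kink f k - r else 0) * y p i) = (kink f k - r) * y k i"
      using k by (simp add: if_distrib[of "\<lambda>x. x * _"] sum.delta cong: if_cong del: sum.lessThan_Suc)
    moreover have "(\<Sum>p<Suc n. (if Suc p = k then r else 0) * y p i) = r * y' i"
    proof (cases k)
      case (Suc l)
      then show ?thesis
        using k by (simp add: y'_def if_distrib[of "\<lambda>x. x * _"] sum.delta cong: if_cong
            del: sum.lessThan_Suc)
    qed (simp add: y'_def)
    ultimately have "t' i = (\<Sum>p<Suc n. (if p < k then kink f p else kink f (Suc p)) * y p i) +
        ((kink f k - r) * y k i + r * y' i)"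
      unfolding t'_eq kink_f' by (simp add: distrib_right sum.distrib del: sum.lessThan_Suc)
    moreover have "t i = t' i + s * e i"
      by (auto simp: t'_def s_def e_def)
    ultimately show ?thesis
      by (simp add: z_eq del: sum.lessThan_Suc)
  qed
  ultimately show ?case
    by blast
qed

section \<open>The projected Minkowski sum as a base polytope\<close>

lemma sum_fun_apply: "(\<Sum>a\<in>A. g a) x = (\<Sum>a\<in>A. g a x)"
  by (induction A rule: infinite_finite_induct) simp_all

text \<open>The bounds of the single hypersimplices, \<open>min k j\<close> for sets of size
  \<open>j\<close>, add up to necessary conditions. Conversely, the total determines the coordinate
  that the projection forgets, and \<open>hypersimplex_decomposition\<close> applies.\<close>

lemma proj_minkowski_hypersimplex:
  assumes "\<forall>k\<in>{1..n}. 0 \<le> u k"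
  shows "(\<lambda>t. restrict t {1..n}) ` (\<Sum>k=1..n. (\<lambda>t. u k *\<^sub>R t) ` hypersimplex k (n + 1)) =
    base_polytope n (\<lambda>j. \<Sum>k=1..n. u k * real (min k j))" (is "_ ` ?M = base_polytope n ?f")
    and "\<And>k. k < n \<Longrightarrow> kink (\<lambda>j. \<Sum>k=1..n. u k * real (min k j)) k = u (Suc k)"
proof -
  show kink_f: "kink ?f k = u (Suc k)" if "k < n" for k
  proof -
    \<comment> \<open>The function \<open>min m\<close> bends only at \<open>m\<close>, so only the
      summand \<open>m = Suc k\<close> has a nonzero second difference.\<close>
    have "kink ?f k = (\<Sum>j=1..n. if j = Suc k then u j else 0)"
      unfolding kink_def sum_distrib_left sum_subtractf[symmetric]
      by (intro sum.cong) (auto simp: min_def algebra_simps le_Suc_eq not_le)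
    then show ?thesis
      using that by simp
  qed
  have f0: "?f 0 = 0"
    by simp
  have f_top: "?f (Suc n) = (\<Sum>k=1..n. u k * real k)" "?f (Suc (Suc n)) = ?f (Suc n)"
    "?f n = ?f (Suc n)"
    by (auto intro!: sum.cong)
  have M: "t \<in> ?M \<longleftrightarrow> (\<exists>y. (\<forall>k\<in>{1..n}. y k \<in> hypersimplex k (Suc n)) \<and>
      (\<forall>i. t i = (\<Sum>k=1..n. u k * y k i)))" for t
  proof
    assume "t \<in> ?M"
    then obtain x where x: "t = sum x {1..n}" "\<forall>k\<in>{1..n}. x k \<in> (\<lambda>t. u k *\<^sub>R t) ` hypersimplex k (n + 1)"
      by (auto simp: set_sum_alt)
    then have "\<forall>k\<in>{1..n}. \<exists>y. y \<in> hypersimplex k (Suc n) \<and> x k = u k *\<^sub>R y"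
      by auto
    then obtain y where y: "\<forall>k\<in>{1..n}. y k \<in> hypersimplex k (Suc n) \<and> x k = u k *\<^sub>R y k"
      by metis
    then have "t i = (\<Sum>k=1..n. u k * y k i)" for i
      using x by (auto simp: scaleR_fun_def sum_fun_apply intro!: sum.cong)
    then show "\<exists>y. (\<forall>k\<in>{1..n}. y k \<in> hypersimplex k (Suc n)) \<and> (\<forall>i. t i = (\<Sum>k=1..n. u k * y k i))"
      using y by blast
  next
    assume "\<exists>y. (\<forall>k\<in>{1..n}. y k \<in> hypersimplex k (Suc n)) \<and> (\<forall>i. t i = (\<Sum>k=1..n. u k * y k i))"
    then obtain y where y: "\<forall>k\<in>{1..n}. y k \<in> hypersimplex k (Suc n)" "\<forall>i. t i = (\<Sum>k=1..n. u k * y k i)"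
      by blast
    then have "t = (\<Sum>k=1..n. u k *\<^sub>R y k)"
      by (auto simp: fun_eq_iff scaleR_fun_def sum_fun_apply)
    then show "t \<in> ?M"
      using y by (auto simp: set_sum_alt)
  qed
  show "(\<lambda>t. restrict t {1..n}) ` ?M = base_polytope n ?f"
  proof (intro subset_antisym subsetI)
    fix t' assume "t' \<in> (\<lambda>t. restrict t {1..n}) ` ?M"
    then obtain t y where t': "t' = restrict t {1..n}"
      and y: "\<And>k. k \<in> {1..n} \<Longrightarrow> y k \<in> hypersimplex k (Suc n)"
      and t: "\<And>i. t i = (\<Sum>k=1..n. u k * y k i)"
      using M by blast
    have sum_t: "sum t I = (\<Sum>k=1..n. u k * sum (y k) I)" for I
      unfolding t by (subst sum.swap) (simp add: sum_distrib_left)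
    have le: "sum t I \<le> ?f (card I)" if "I \<subseteq> {1..Suc n}" for I
      unfolding sum_t using assms by (intro sum_mono mult_left_mono hypersimplexD(3)[OF y that]) auto
    have total: "sum t {1..Suc n} = ?f (Suc n)"
      unfolding sum_t f_top(1) by (intro sum.cong refl) (simp only: hypersimplexD(2)[OF y])
    have "?f (Suc n) - ?f (Suc n - card I) \<le> sum t' I \<and> sum t' I \<le> ?f (card I)"
      if "I \<in> Pow {1..n}" for I
    proof -
      have I: "I \<subseteq> {1..Suc n}" "finite I"
        using that finite_subset by fastforce+
      \<comment> \<open>As the total is fixed, the upper bound for the complement is the lower bound
        for \<open>I\<close>.\<close>
      have "sum t ({1..Suc n} - I) \<le> ?f (card ({1..Suc n} - I))"
        by (rule le) auto
      moreover have "sum t ({1..Suc n} - I) = ?f (Suc n) - sum t I"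
        using I total by (simp add: sum_diff)
      moreover have "card ({1..Suc n} - I) = Suc n - card I"
        using I by (simp add: card_Diff_subset)
      moreover have "sum t' I = sum t I"
        using that unfolding t' by (intro sum.cong) auto
      ultimately show ?thesis
        using le[OF I(1)] by simp
    qed
    then show "t' \<in> base_polytope n ?f"
      unfolding base_polytope_def by (simp add: t')
  next
    fix t' assume "t' \<in> base_polytope n ?f"
    then have ext: "t' \<in> {1..n} \<rightarrow>\<^sub>E UNIV"
      and t': "\<And>I. I \<subseteq> {1..n} \<Longrightarrow> ?f (Suc n) - ?f (Suc n - card I) \<le> sum t' I \<and> sum t' I \<le> ?f (card I)"
      by (auto simp: base_polytope_def)
    define t where "t i = (if i \<in> {1..n} then t' i else if i = Suc n then ?f (Suc n) - sum t' {1..n} else 0)"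
      for i
    have sum_t: "sum t I = sum t' I" if "I \<subseteq> {1..n}" for I
      using that by (intro sum.cong) (auto simp: t_def)
    have ins: "{1..Suc n} = insert (Suc n) {1..n}"
      by auto
    have "\<exists>y. (\<forall>k<Suc n. y k \<in> hypersimplex (Suc k) (Suc n)) \<and>
        (\<forall>i. t i = (\<Sum>k<Suc n. kink ?f k * y k i))"
    proof (rule hypersimplex_decomposition)
      show "?f 0 = 0" "?f (Suc (Suc n)) = ?f (Suc n)"
        by (fact f0 f_top)+
      show "\<forall>k<n. 0 \<le> kink ?f k"
        using kink_f assms by auto
      show "\<forall>i. i \<notin> {1..Suc n} \<longrightarrow> t i = 0"
        by (auto simp: t_def)
      show "sum t {1..Suc n} = ?f (Suc n)"
        unfolding ins using sum_t[of "{1..n}"] by (simp add: t_def)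
      show "\<forall>I\<in>Pow {1..Suc n}. sum t I \<le> ?f (card I)"
      proof
        fix I assume I: "I \<in> Pow {1..Suc n}"
        show "sum t I \<le> ?f (card I)"
        proof (cases "Suc n \<in> I")
          case False
          then have "I \<subseteq> {1..n}"
            using I by (auto simp: le_Suc_eq)
          then show ?thesis
            using t' sum_t by metis
        next
          case True
          define J where "J = I - {Suc n}"
          have J: "J \<subseteq> {1..n}" "I = insert (Suc n) J" "finite J" "Suc n \<notin> J"
            using I True by (auto simp: J_def le_Suc_eq intro: finite_subset)
          have cJ: "card J \<le> n" "card ({1..n} - J) = n - card J"
            using card_mono[of "{1..n}" J] J by (auto simp: card_Diff_subset)
          \<comment> \<open>Conversely, the upper bound for a set containing \<open>Suc n\<close> is
            the lower bound for its complement, which lies in \<open>{1..n}\<close>.\<close>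
          have "?f (Suc n) - ?f (Suc n - card ({1..n} - J)) \<le> sum t' ({1..n} - J)"
            using t'[of "{1..n} - J"] by blast
          moreover have "sum t' ({1..n} - J) = sum t' {1..n} - sum t' J"
            using J by (simp add: sum_diff)
          moreover have "Suc n - card ({1..n} - J) = card I"
            using J cJ by simp
          moreover have "sum t I = ?f (Suc n) - sum t' {1..n} + sum t' J"
            using J sum_t[of J] by (simp add: t_def)
          ultimately show ?thesis
            by simp
        qed
      qed
    qed
    then obtain y where y: "\<And>k. k < Suc n \<Longrightarrow> y k \<in> hypersimplex (Suc k) (Suc n)"
      "\<And>i. t i = (\<Sum>k<Suc n. kink ?f k * y k i)"
      by blast
    \<comment> \<open>\<open>?f\<close> is constant from \<open>n\<close> on, so the single-point
      summand drops out.\<close>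
    have "kink ?f n = 0"
      using f_top by (simp add: kink_def)
    then have "t i = (\<Sum>k<n. u (Suc k) * y k i)" for i
      using y(2)[of i] kink_f by simp
    then have "t i = (\<Sum>k=1..n. u k * y (k - 1) i)" for i
      by (simp add: sum.atLeast1_atMost_eq)
    moreover have "y (k - 1) \<in> hypersimplex k (Suc n)" if "k \<in> {1..n}" for k
      using y(1)[of "k - 1"] that by auto
    ultimately have "t \<in> ?M"
      unfolding M by (intro exI[of _ "\<lambda>k. y (k - 1)"]) blast
    moreover have "restrict t {1..n} = t'"
      using ext by (auto simp: t_def fun_eq_iff PiE_iff extensional_def)
    ultimately show "t' \<in> (\<lambda>t. restrict t {1..n}) ` ?M"
      by blast
  qed
qed

section \<open>Mixed Eulerian numbers as coefficients\<close>

text \<open>Uniqueness of base \<open>B\<close> digits: the remainder recovers the head and the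
  quotient the rest.\<close>

lemma horner_sum_inj:
  fixes c d :: "nat list"
  assumes "length c = length d" "\<forall>x\<in>set c. x < B" "\<forall>x\<in>set d. x < B"
    and "horner_sum (\<lambda>x. x) B c = horner_sum (\<lambda>x. x) B d"
  shows "c = d"
  using assms
proof (induction c d rule: list_induct2)
  case (Cons x xs y ys)
  then have eq: "x + B * horner_sum (\<lambda>x. x) B xs = y + B * horner_sum (\<lambda>x. x) B ys" and "x < B" "y < B"
    by simp_all
  have "x = y"
    using arg_cong[OF eq, of "\<lambda>z. z mod B"] \<open>x < B\<close> \<open>y < B\<close> by simp
  moreover have "horner_sum (\<lambda>x. x) B xs = horner_sum (\<lambda>x. x) B ys"
    using arg_cong[OF eq, of "\<lambda>z. z div B"] \<open>x < B\<close> \<open>y < B\<close> by simp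
  ultimately show ?case
    using Cons by simp
qed simp

text \<open>
  Kronecker's substitution $u_k = T^{(n+1)^{k-1}}$ separates the monomials, since no exponent
  exceeds \<open>n\<close>.
\<close>

lemma volume_coefficients_unique:
  fixes D :: "nat list \<Rightarrow> real"
  assumes "\<And>u :: nat \<Rightarrow> real. \<forall>k\<in>{1..n}. 0 \<le> u k \<Longrightarrow>
      (\<Sum>c\<in>weak_comps n. D c * (\<Prod>k=1..n. u k ^ (c ! (k - 1)) / fact (c ! (k - 1)))) = 0"
    and "c \<in> weak_comps n"
  shows "D c = 0"
proof -
  \<comment> \<open>\<open>e c\<close> is the exponent of \<open>T\<close> after the substitution,
    that is \<open>c\<close> read as digits in base \<open>n + 1\<close>; \<open>q c\<close>
    collects the factorials.\<close>
  define e where "e c = horner_sum (\<lambda>x. x) (Suc n) c" for c :: "nat list"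
  define q where "q c = (\<Prod>k=1..n. fact (c ! (k - 1)) :: real)" for c :: "nat list"
  define p where "p = (\<Sum>c\<in>weak_comps n. monom (D c / q c) (e c))"
  have e_eq: "e c = (\<Sum>k=1..n. Suc n ^ (k - 1) * c ! (k - 1))" if "c \<in> weak_comps n" for c
    using that unfolding e_def horner_sum_eq_sum
    by (simp add: weak_comps_def atLeast0LessThan sum.atLeast1_atMost_eq mult.commute)
  have "poly p T = 0" if "0 \<le> T" for T
  proof -
    have "poly p T = (\<Sum>c\<in>weak_comps n. D c *
        (\<Prod>k=1..n. (T ^ (Suc n ^ (k - 1))) ^ (c ! (k - 1)) / fact (c ! (k - 1))))"
      by (simp add: p_def poly_sum poly_monom prod_dividef q_def e_eq power_sum flip: power_mult)
    then show ?thesis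
      using assms(1)[of "\<lambda>k. T ^ (Suc n ^ (k - 1))"] that by simp
  qed
  then have "{0..} \<subseteq> {T. poly p T = 0}"
    by auto
  then have "infinite {T. poly p T = 0}"
    using finite_subset infinite_Ici by blast
  then have "p = 0"
    using poly_roots_finite by blast
  then have "coeff p (e c) = 0"
    by simp
  then have "(\<Sum>d\<in>weak_comps n. if e d = e c then D d / q d else 0) = 0"
    by (simp add: p_def coeff_sum)
  moreover have "e d = e c \<longleftrightarrow> d = c" if "d \<in> weak_comps n" for d
  proof -
    have "x < Suc n" if "x \<in> set b" "b \<in> weak_comps n" for x b
      using member_le_sum_list[OF that(1)] that(2) by (simp add: weak_comps_def)
    then show ?thesis
      unfolding e_def using horner_sum_inj[of d c "Suc n"] that assms(2)
      by (auto simp: weak_comps_def)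
  qed
  then have "(\<Sum>d\<in>weak_comps n. if e d = e c then D d / q d else 0) =
      (\<Sum>d\<in>weak_comps n. if d = c then D d / q d else 0)"
    by (intro sum.cong) auto
  ultimately have "D c / q c = 0"
    using assms(2) finite_weak_comps[of n] by simp
  moreover have "q c \<noteq> 0"
    by (simp add: q_def)
  ultimately show ?thesis
    by simp
qed

lemma append_zero_in_comps: "c @ [0] \<in> comps (Suc n) n \<longleftrightarrow> c \<in> weak_comps n"
  by (simp add: comps_def weak_comps_def)

lemma dmonom_eq_prod:
  assumes "length c = n"
  shows "dmonom (map f [0..<n]) c = (\<Prod>k=1..n. f (k - 1) ^ (c ! (k - 1)) / fact (c ! (k - 1)))"
  using assms
  by (simp add: dmonom_def prod.list_conv_set_nth dpow_def atLeast0LessThan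
      prod.atLeast1_atMost_eq)

text \<open>With the dummy parameter set to 0, monomials with a positive last exponent vanish and
  the sum reduces to \<open>weak_comps n\<close>.\<close>

lemma proj_vol_minkowski_hypersimplex:
  assumes "\<forall>k\<in>{1..n}. 0 \<le> u k"
  shows "proj_vol n (\<Sum>k=1..n. (\<lambda>t. u k *\<^sub>R t) ` hypersimplex k (n + 1)) =
    (\<Sum>c\<in>weak_comps n. real (cyc_eulerian n (c @ [0])) *
      (\<Prod>k=1..n. u k ^ (c ! (k - 1)) / fact (c ! (k - 1))))"
proof -
  let ?f = "\<lambda>j. \<Sum>k=1..n. u k * real (min k j)"
  let ?vs = "map (\<lambda>k. u (Suc k)) [0..<n] @ [0]"
  have vs: "?vs = map (kink ?f) [0..<n] @ [0]"
    using proj_minkowski_hypersimplex(2)[OF assms] by simp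
  have "emeasure (\<Pi>\<^sub>M i\<in>{1..n}. lborel) (base_polytope n ?f) = ennreal (vol_poly n ?vs)"
    unfolding vs
  proof (rule emeasure_base_polytope)
    show "\<forall>k<n. 0 \<le> kink ?f k"
    proof (intro allI impI)
      fix k assume "k < n"
      then show "0 \<le> kink ?f k"
        unfolding proj_minkowski_hypersimplex(2)[OF assms \<open>k < n\<close>] using assms by simp
    qed
  qed simp_all
  moreover have "0 \<le> vol_poly n ?vs"
    using assms by (intro vol_poly_nonneg) auto
  ultimately have "proj_vol n (\<Sum>k=1..n. (\<lambda>t. u k *\<^sub>R t) ` hypersimplex k (n + 1)) = vol_poly n ?vs"
    unfolding proj_vol_def proj_minkowski_hypersimplex(1)[OF assms] measure_def by simp
  also have "\<dots> = (\<Sum>c\<in>(\<lambda>c. c @ [0]) ` weak_comps n. real (cyc_eulerian n c) * dmonom ?vs c)"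
    unfolding vol_poly_def
  proof (rule sum.mono_neutral_right)
    show "(\<lambda>c. c @ [0]) ` weak_comps n \<subseteq> comps (Suc n) n"
      by (auto simp: append_zero_in_comps)
    show "\<forall>c\<in>comps (Suc n) n - (\<lambda>c. c @ [0]) ` weak_comps n. real (cyc_eulerian n c) * dmonom ?vs c = 0"
    proof
      fix c assume c: "c \<in> comps (Suc n) n - (\<lambda>c. c @ [0]) ` weak_comps n"
      then obtain d a where "c = d @ [a]"
        by (cases c rule: rev_cases) (auto simp: comps_def)
      moreover from this have "a \<noteq> 0" "length d = n"
        using c append_zero_in_comps[of d n] by (auto simp: comps_def)
      ultimately show "real (cyc_eulerian n c) * dmonom ?vs c = 0"
        by (simp add: dpow_zero)
    qed
  qed (fact finite_comps)
  also have "\<dots> = (\<Sum>c\<in>weak_comps n. real (cyc_eulerian n (c @ [0])) * dmonom ?vs (c @ [0]))"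
    by (subst sum.reindex) (auto intro: inj_onI)
  also have "\<dots> = (\<Sum>c\<in>weak_comps n. real (cyc_eulerian n (c @ [0])) *
      (\<Prod>k=1..n. u k ^ (c ! (k - 1)) / fact (c ! (k - 1))))"
    by (intro sum.cong) (auto simp: weak_comps_def dmonom_eq_prod intro!: prod.cong)
  finally show ?thesis .
qed

text \<open>The volume formula gives existence and \<open>volume_coefficients_unique\<close> gives
  uniqueness, which resolves the definite description.\<close>

lemma mixed_eulerian_eq:
  assumes "c \<in> weak_comps n"
  shows "mixed_eulerian n c = real (cyc_eulerian n (c @ [0]))"
proof -
  define A where "A c = (if c \<in> weak_comps n then real (cyc_eulerian n (c @ [0])) else 0)" for c
  have A: "proj_vol n (\<Sum>k=1..n. (\<lambda>t. u k *\<^sub>R t) ` hypersimplex k (n + 1)) =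
      (\<Sum>c\<in>weak_comps n. A c * (\<Prod>k=1..n. u k ^ (c ! (k - 1)) / fact (c ! (k - 1))))"
    if "\<forall>k\<in>{1..n}. 0 \<le> u k" for u
    unfolding proj_vol_minkowski_hypersimplex[OF that] by (intro sum.cong) (auto simp: A_def)
  have "mixed_eulerian n = A"
    unfolding mixed_eulerian_def
  proof (rule the_equality, intro conjI allI impI)
    show "A c = 0" if "c \<notin> weak_comps n" for c
      using that by (simp add: A_def)
    fix B :: "nat list \<Rightarrow> real"
    assume B: "(\<forall>c. c \<notin> weak_comps n \<longrightarrow> B c = 0) \<and>
      (\<forall>u. (\<forall>k\<in>{1..n}. 0 \<le> u k) \<longrightarrow>
        proj_vol n (\<Sum>k=1..n. (\<lambda>t. u k *\<^sub>R t) ` hypersimplex k (n + 1)) =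
        (\<Sum>c\<in>weak_comps n. B c * (\<Prod>k=1..n. u k ^ (c ! (k - 1)) / fact (c ! (k - 1)))))"
    have "B c - A c = 0" if "c \<in> weak_comps n" for c
    proof (rule volume_coefficients_unique[OF _ that])
      fix u :: "nat \<Rightarrow> real" assume "\<forall>k\<in>{1..n}. 0 \<le> u k"
      with A B show "(\<Sum>c\<in>weak_comps n. (B c - A c) *
          (\<Prod>k=1..n. u k ^ (c ! (k - 1)) / fact (c ! (k - 1)))) = 0"
        by (simp add: left_diff_distrib sum_subtractf)
    qed
    then show "B = A"
      using B by (fastforce simp: A_def)
  qed (use A in blast)
  then show ?thesis
    using assms by (simp add: A_def)
qed

section \<open>Cyclic classes\<close>

lemma sum_periodic:
  fixes g :: "nat \<Rightarrow> nat"
  assumes "\<And>i. g (i + p) = g i"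
  shows "(\<Sum>i<q * p. g i) = q * (\<Sum>i<p. g i)"
proof (induction q)
  case (Suc q)
  have periodic: "g (i + r * p) = g i" for i r
  proof (induction r)
    case (Suc r)
    then show ?case
      using assms[of "i + r * p"] by (simp add: algebra_simps)
  qed simp
  have "(\<Sum>i<a + b. g i) = (\<Sum>i<a. g i) + (\<Sum>i<b. g (i + a))" for a b
    by (induction b) (simp_all add: add.commute add.left_commute)
  from this[of "q * p" p]
  have "(\<Sum>i<q * p + p. g i) = (\<Sum>i<q * p. g i) + (\<Sum>i<p. g (i + q * p))" .
  then show ?case
    using Suc by (simp add: periodic add.commute)
qed simp

text \<open>
  If a shift by \<open>j\<close> fixes the sequence, summing its periodic extension over $j(n+1)$ terms in two ways
  shows that $n + 1$ divides $jn$.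
\<close>

lemma rotate_comps_inj:
  assumes "c \<in> comps (Suc n) n"
  shows "inj_on (\<lambda>j. rotate j c) {..<Suc n}"
proof -
  have len: "length c = Suc n" and sum: "sum_list c = n"
    using assms by (auto simp: comps_def)
  have no_fix: "Suc n dvd j" if "rotate j d = d" "d \<in> comps (Suc n) n" for j d
  proof -
    define g where "g i = d ! (i mod Suc n)" for i
    have len: "length d = Suc n" and sum: "sum_list d = n"
      using that(2) by (auto simp: comps_def)
    have "g (i + j) = g i" for i
    proof -
      have "rotate j d ! (i mod Suc n) = g (i + j)"
        using len by (subst nth_rotate) (auto simp: g_def mod_add_left_eq add.commute mod_simps)
      then show ?thesis
        using that by (simp add: g_def)
    qed
    then have 1: "(\<Sum>i<Suc n * j. g i) = Suc n * (\<Sum>i<j. g i)"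
      by (rule sum_periodic)
    have "(\<Sum>i<j * Suc n. g i) = j * (\<Sum>i<Suc n. g i)"
      by (rule sum_periodic) (simp only: g_def mod_add_self2)
    also have "(\<Sum>i<Suc n. g i) = sum_list d"
      using len by (simp add: sum_list_sum_nth atLeast0LessThan g_def del: sum.lessThan_Suc)
    finally have "Suc n * (\<Sum>i<j. g i) = j * n"
      using 1 sum by (simp add: mult.commute)
    then have "Suc n dvd j * n"
      by (metis dvd_triv_left)
    moreover have "coprime (Suc n) n"
      by simp
    ultimately show ?thesis
      using coprime_dvd_mult_left_iff by blast
  qed
  have le: "i = j" if "rotate i c = rotate j c" "i \<le> j" "j < Suc n" for i j
  proof -
    have "rotate (j - i) (rotate i c) = rotate i c"
      using that(1,2) by (metis le_add_diff_inverse2 rotate_rotate)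
    moreover have "rotate i c \<in> comps (Suc n) n"
      using assms by (simp add: comps_def sum_list_rotate)
    ultimately have "Suc n dvd j - i"
      by (rule no_fix)
    then show ?thesis
      using that dvd_imp_le[of "Suc n" "j - i"] by (cases "i = j") auto
  qed
  show ?thesis
  proof (rule inj_onI)
    fix i j assume "i \<in> {..<Suc n}" "j \<in> {..<Suc n}" "rotate i c = rotate j c"
    then show "i = j"
      using le[of i j] le[of j i] by (cases "i \<le> j") auto
  qed
qed

section \<open>Orbits under rotation\<close>

definition orbit :: "nat list \<Rightarrow> nat list set" where
  "orbit c = (\<lambda>j. rotate j c) ` {..<length c}"

lemma orbit_altdef:
  assumes "c \<noteq> []"
  shows "orbit c = {d. \<exists>m. d = rotate m c}"
proof -
  have "rotate m c \<in> orbit c" for m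
    unfolding orbit_def using assms by (subst rotate_conv_mod) auto
  then show ?thesis
    unfolding orbit_def by auto
qed

lemma orbit_rotate:
  assumes "c \<noteq> []"
  shows "orbit (rotate m c) = orbit c"
proof -
  have "rotate k c = rotate (k + (length c - m mod length c)) (rotate m c)" for k
  proof -
    have le: "m mod length c \<le> length c"
      using assms by (simp add: less_imp_le)
    have "rotate (k + (length c - m mod length c)) (rotate m c) =
        rotate (k + (length c - m mod length c)) (rotate (m mod length c) c)"
      by (metis rotate_conv_mod)
    also have "\<dots> = rotate (k + length c) c"
      using le by (simp add: rotate_rotate)
    also have "\<dots> = rotate k c"
      by (simp flip: rotate_rotate)
    finally show ?thesis
      by simp
  qed
  then show ?thesis
    using assms by (auto simp: orbit_altdef rotate_rotate)
qed

lemma orbit_eq_iff: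
  assumes "c \<noteq> []" "d \<noteq> []"
  shows "d \<in> orbit c \<longleftrightarrow> orbit d = orbit c"
proof
  assume "d \<in> orbit c"
  then obtain m where "d = rotate m c"
    using assms by (auto simp: orbit_def)
  then show "orbit d = orbit c"
    using assms orbit_rotate by simp
next
  assume "orbit d = orbit c"
  moreover have "d \<in> orbit d"
    using assms by (auto simp: orbit_altdef intro: exI[of _ 0])
  ultimately show "d \<in> orbit c"
    by simp
qed

text \<open>Members of the orbit ending in 0 are exactly those of the form \<open>d @ [0]\<close>;
  orbit membership is symmetric, so the direction of the rotation does not matter.\<close>

lemma cyclic_class_eq:
  assumes "c \<in> weak_comps n"
  shows "(\<lambda>d. d @ [0]) ` (cyclic_equiv n `` {c}) = {d \<in> orbit (c @ [0]). last d = 0}"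
proof -
  have 1: "d \<in> cyclic_equiv n `` {c} \<longleftrightarrow> d @ [0] \<in> orbit (c @ [0])" if "d \<in> weak_comps n" for d
  proof -
    have "(c, d) \<in> cyclic_equiv n \<longleftrightarrow> c @ [0] \<in> orbit (d @ [0])"
      using assms that by (simp add: cyclic_equiv_def orbit_altdef)
    also have "\<dots> \<longleftrightarrow> d @ [0] \<in> orbit (c @ [0])"
      by (auto simp: orbit_eq_iff)
    finally show ?thesis
      by simp
  qed
  show ?thesis
  proof (intro subset_antisym subsetI)
    fix d assume "d \<in> (\<lambda>d. d @ [0]) ` (cyclic_equiv n `` {c})"
    then show "d \<in> {d \<in> orbit (c @ [0]). last d = 0}"
      using 1 by (auto simp: cyclic_equiv_def)
  next
    fix d assume d: "d \<in> {d \<in> orbit (c @ [0]). last d = 0}"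
    then have "d \<in> comps (Suc n) n"
      using assms by (auto simp: orbit_def comps_def weak_comps_def sum_list_rotate)
    then obtain b where "d = b @ [0]"
      using d by (cases d rule: rev_cases) (auto simp: comps_def)
    then show "d \<in> (\<lambda>d. d @ [0]) ` (cyclic_equiv n `` {c})"
      using 1[of b] d \<open>d \<in> comps (Suc n) n\<close> by (auto simp: append_zero_in_comps)
  qed
qed

lemma orbit_subset_comps: "c \<in> comps m d \<Longrightarrow> orbit c \<subseteq> comps m d"
  by (auto simp: orbit_def comps_def sum_list_rotate)

text \<open>Among \<open>n + 1\<close> natural numbers with sum \<open>n\<close> one is 0, and it
  can be rotated to the end.\<close>

lemma ex_zero_in_orbit:
  assumes "c \<in> comps (Suc n) n"
  shows "\<exists>b\<in>weak_comps n. c \<in> orbit (b @ [0])"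
proof -
  have len: "length c = Suc n" and sum: "sum_list c = n"
    using assms by (auto simp: comps_def)
  have "\<exists>i<Suc n. c ! i = 0"
  proof (rule ccontr)
    assume "\<not> (\<exists>i<Suc n. c ! i = 0)"
    then have "(\<Sum>i<Suc n. 1) \<le> (\<Sum>i<Suc n. c ! i)"
      by (intro sum_mono) (auto simp: Suc_le_eq)
    then show False
      using len sum by (simp add: sum_list_sum_nth atLeast0LessThan)
  qed
  then obtain i where i: "i < Suc n" "c ! i = 0"
    by blast
  define d where "d = rotate (Suc i) c"
  have "d \<in> comps (Suc n) n"
    using assms sum_list_rotate[of "Suc i" c] by (simp add: d_def comps_def)
  moreover have "(Suc i + n) mod Suc n = i"
    using i by (metis add_Suc_shift mod_add_self2 mod_less)
  then have "d ! n = 0"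
    using len i unfolding d_def by (subst nth_rotate) auto
  ultimately obtain b where b: "d = b @ [0]"
    by (cases d rule: rev_cases) (auto simp: comps_def)
  have "c \<noteq> []"
    using len by auto
  then have "c \<in> orbit d"
    using orbit_rotate[of c "Suc i"] len unfolding d_def
    by (subst orbit_eq_iff) (auto simp del: rotate_Suc)
  then show ?thesis
    using b \<open>d \<in> comps (Suc n) n\<close> by (auto simp: append_zero_in_comps)
qed

text \<open>Members of the orbit that do not end in 0 contribute 0, so the class sum is the sum over
  the whole orbit, where each of the \<open>n + 1\<close> rotations occurs once.\<close>

lemma sum_cyclic_class_mixed_eulerian:
  assumes "c \<in> weak_comps n"
  shows "(\<Sum>c'\<in>cyclic_equiv n `` {c}. mixed_eulerian n c') = fact n"
proof -
  let ?c = "c @ [0]"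
  have c: "?c \<in> comps (Suc n) n"
    using assms by (simp add: append_zero_in_comps)
  have "(\<Sum>c'\<in>cyclic_equiv n `` {c}. mixed_eulerian n c') =
      (\<Sum>c'\<in>cyclic_equiv n `` {c}. real (cyc_eulerian n (c' @ [0])))"
    by (intro sum.cong) (auto simp: cyclic_equiv_def mixed_eulerian_eq)
  also have "\<dots> = (\<Sum>d\<in>(\<lambda>d. d @ [0]) ` (cyclic_equiv n `` {c}). real (cyc_eulerian n d))"
    by (subst sum.reindex) (auto intro: inj_onI)
  also have "\<dots> = (\<Sum>d\<in>{d \<in> orbit ?c. last d = 0}. real (cyc_eulerian n d))"
    by (simp only: cyclic_class_eq[OF assms])
  also have "\<dots> = (\<Sum>d\<in>orbit ?c. real (cyc_eulerian n d))"
  proof (rule sum.mono_neutral_left)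
    show "\<forall>d\<in>orbit ?c - {d \<in> orbit ?c. last d = 0}. real (cyc_eulerian n d) = 0"
    proof
      fix d assume d: "d \<in> orbit ?c - {d \<in> orbit ?c. last d = 0}"
      then have "d \<in> comps (Suc n) n"
        using orbit_subset_comps[OF c] by blast
      then have "length d = Suc n" "sum_list d = n" "d ! n = last d"
        using last_conv_nth[of d] by (cases "d = []"; simp add: comps_def)+
      then show "real (cyc_eulerian n d) = 0"
        using d cyc_eulerian_eq_0[of d n] by auto
    qed
  qed (auto simp: orbit_def)
  also have "\<dots> = (\<Sum>j<Suc n. real (cyc_eulerian n (rotate j ?c)))"
    using assms rotate_comps_inj[OF c] unfolding orbit_def
    by (subst sum.reindex) (auto simp: weak_comps_def)
  also have "\<dots> = fact n"
    using arg_cong[OF sum_cyc_eulerian_rotate[of ?c n], of real] c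
    by (simp add: comps_def del: sum.lessThan_Suc)
  finally show ?thesis .
qed

text \<open>The sequences of length \<open>n + 1\<close> and sum \<open>n\<close> split into orbits
  of size \<open>n + 1\<close>, one for each class.\<close>

lemma card_cyclic_classes:
  "Suc n * card (weak_comps n // cyclic_equiv n) = (2 * n) choose n"
proof -
  \<comment> \<open>All members of a class have the same orbit, so the union is that orbit and no
    representative has to be chosen.\<close>
  define Orb where "Orb C = (\<Union>c\<in>C. orbit (c @ [0]))" for C
  have Orb: "Orb (cyclic_equiv n `` {c}) = orbit (c @ [0])" if "c \<in> weak_comps n" for c
  proof -
    have "orbit (d @ [0]) = orbit (c @ [0])" if "d \<in> cyclic_equiv n `` {c}" for d
      using that orbit_rotate[of "d @ [0]"] by (auto simp: cyclic_equiv_def)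
    moreover have "c \<in> cyclic_equiv n `` {c}"
      using that equiv_class_self[OF equiv_cyclic_equiv] by blast
    ultimately show ?thesis
      unfolding Orb_def by blast
  qed
  have finite_quot: "finite (weak_comps n // cyclic_equiv n)"
    using finite_weak_comps[of n] by (simp add: quotient_def)
  have "comps (Suc n) n = (\<Union>C\<in>weak_comps n // cyclic_equiv n. Orb C)"
  proof (intro subset_antisym subsetI)
    fix c assume "c \<in> comps (Suc n) n"
    then obtain b where "b \<in> weak_comps n" "c \<in> orbit (b @ [0])"
      using ex_zero_in_orbit by blast
    then show "c \<in> (\<Union>C\<in>weak_comps n // cyclic_equiv n. Orb C)"
      using Orb by (auto simp: quotient_def)
  next
    fix c assume "c \<in> (\<Union>C\<in>weak_comps n // cyclic_equiv n. Orb C)"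
    then obtain b where "b \<in> weak_comps n" "c \<in> orbit (b @ [0])"
      using Orb by (auto simp: quotient_def)
    then show "c \<in> comps (Suc n) n"
      using orbit_subset_comps[of "b @ [0]" "Suc n" n] by (auto simp: append_zero_in_comps)
  qed
  moreover have "card (\<Union>C\<in>weak_comps n // cyclic_equiv n. Orb C) =
      (\<Sum>C\<in>weak_comps n // cyclic_equiv n. card (Orb C))"
  proof (rule card_UN_disjoint[OF finite_quot])
    show "\<forall>C\<in>weak_comps n // cyclic_equiv n. finite (Orb C)"
      using Orb by (auto simp: quotient_def orbit_def)
    show "\<forall>C\<in>weak_comps n // cyclic_equiv n. \<forall>C'\<in>weak_comps n // cyclic_equiv n.
        C \<noteq> C' \<longrightarrow> Orb C \<inter> Orb C' = {}"
    proof (intro ballI impI, rule ccontr)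
      fix C C' assume CC': "C \<in> weak_comps n // cyclic_equiv n" "C' \<in> weak_comps n // cyclic_equiv n"
        "C \<noteq> C'" "Orb C \<inter> Orb C' \<noteq> {}"
      obtain c c' where c: "c \<in> weak_comps n" "C = cyclic_equiv n `` {c}"
        "c' \<in> weak_comps n" "C' = cyclic_equiv n `` {c'}"
        using CC'(1,2) by (auto simp: quotient_def)
      obtain d where "d \<in> orbit (c @ [0])" "d \<in> orbit (c' @ [0])"
        using CC'(4) c Orb by auto
      moreover from this have "d \<noteq> []"
        by (auto simp: orbit_def)
      ultimately have "orbit (c @ [0]) = orbit (c' @ [0])"
        by (simp add: orbit_eq_iff)
      \<comment> \<open>A class is recovered from its orbit as the members ending in 0.\<close>
      then have "(\<lambda>d. d @ [0]) ` C = (\<lambda>d. d @ [0]) ` C'"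
        using c by (simp add: cyclic_class_eq)
      then show False
        using CC'(3) by (subst (asm) inj_image_eq_iff) (auto intro: injI)
    qed
  qed
  moreover have "card (Orb C) = Suc n" if "C \<in> weak_comps n // cyclic_equiv n" for C
  proof -
    obtain c where c: "c \<in> weak_comps n" "C = cyclic_equiv n `` {c}"
      using \<open>C \<in> weak_comps n // cyclic_equiv n\<close> by (elim quotientE)
    then have "c @ [0] \<in> comps (Suc n) n" "length (c @ [0]) = Suc n"
      by (auto simp: append_zero_in_comps weak_comps_def)
    then show ?thesis
      using c Orb card_image[OF rotate_comps_inj] by (simp add: orbit_def)
  qed
  \<comment> \<open>Stars and bars.\<close>
  moreover have "card (comps (Suc n) n) = (2 * n) choose n"
    using card_length_sum_list[of "Suc n" n] by (simp add: comps_def mult_2)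
  ultimately show ?thesis
    by (simp add: mult.commute)
qed

theorem theorem16p4:
  fixes n :: nat
  assumes "n \<ge> 1"
  shows "(\<forall>c\<in>weak_comps n. (\<Sum>c'\<in>cyclic_equiv n `` {c}. mixed_eulerian n c') = fact n) \<and>
         real (card (weak_comps n // cyclic_equiv n)) =
           1 / (real n + 1) * real ((2 * n) choose n)"
proof
  show "\<forall>c\<in>weak_comps n. (\<Sum>c'\<in>cyclic_equiv n `` {c}. mixed_eulerian n c') = fact n"
    using sum_cyclic_class_mixed_eulerian by blast
  show "real (card (weak_comps n // cyclic_equiv n)) = 1 / (real n + 1) * real ((2 * n) choose n)"
    using arg_cong[OF card_cyclic_classes[of n], of real] by (simp add: field_simps)
qed

end
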